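(* Fix $s>0$ and an integer $K\ge1$. Let $G\subset\mathit{Conf}$ be a dense $G_\delta$ set and $\mathcal H\subset\mathbb S^1$ a dense $G_\delta$ set of full Lebesgue measure such that for every $g\in G$ and $\theta\in\mathcal H$ the billiard flow $\phi_t^{g,\theta}$ has infinite ergodic index. For $\vec z=(z_1,\dots,z_K)\in(\mathcal B^g)^K$, $\vec\theta=(\vec\theta_1,\dots,\vec\theta_K)\in[\theta]^K$ and $i\in[\theta]=\{\pm\theta,\pm(\pi-\theta)\}$ let $$\hat f_i(\vec z,\vec\theta)=\sum_{\{k:\ \vec\theta_k=i\}}\frac{1}{\max(1,|z_k|^3)}.$$ Then for each $g\in G$, each $\theta\in\mathcal H$, and all $i,j\in[\theta]$, for $\mu^K$-almost every initial condition $(\vec z,\vec\theta)$ with $\vec z\in(\mathcal B^g)^K$ and $\vec\theta\in[\theta]^K$, $$\frac{\int_0^T \hat f_i\big((\phi_t^{g,\theta}\times\cdots\times\phi_t^{g,\theta})(\vec z,\vec\theta)\big)\,dt}{\int_0^T \hat f_j\big((\phi_t^{g,\theta}\times\cdots\times\phi_t^{g,\theta})(\vec z,\vec\theta)\big)\,dt}\longrightarrow 1\qquad\text{as }T\to\infty,$$ where the product flow has $K$ factors.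
   Context: Configurations. Let $d$ be the $L^1$ distance on $\mathbb R^2$. A rhombus is a square with sides parallel to the lines $y=\pm x$. Fix $s>0$. A configuration is an at most countable (possibly finite or empty) subset $g\subset\mathbb R^2$ such that $d(z_1,z_2)\ge s$ for all distinct $z_1,z_2\in g$; it encodes the collection of rhombi ("trees") $\{w: d(w,z)\le s/2\}$, $z\in g$. $\mathit{Conf}$ is the set of all configurations. Its topology is given by the metric $d_H$: via inverse stereographic projection (polar coordinates $(r,\theta)$ go to the point of the unit sphere with spherical coordinates $(2\arctan(1/r),\theta)$, first coordinate measured from the north pole $\infty$), let $\hat g$ be the image of $g$ together with $\infty$; $d_H(g_1,g_2)$ is the Hausdorff distance between $\hat g_1$ and $\hat g_2$ with respect to the geodesic distance on the sphere. Billiard flow. The wind-tree table $\mathcal B^g$ is $\mathbb R^2$ minus the interiors of the trees of $g$. For $\theta\in\mathbb S^1$, the billiard flow $\phi_t^{g,\theta}$ in direction $\theta$ is unit speed free motion in the interior of $\mathcal B^g$ with elastic reflection at the boundary of the trees; orbits hitting a corner stop and are not defined afterwards. Measuring angles from a side direction of the trees, only the directions $[\theta]=\{\pm\theta,\pm(\pi-\theta)\}$ occur, so the phase space is a subset of $\mathcal B^g\times[\theta]$. The flow preserves the (infinite) measure $\mu$ which is area on $\mathcal B^g$ times counting (up to a constant) measure on $[\theta]$; $\mu^K=\mu\times\cdots\times\mu$. $|z|$ denotes the distance of $z\in\mathbb R^2$ from the origin. Ergodicity. A flow $\psi_t$ preserving a Borel measure $m$ (possibly infinite) is ergodic if every Borel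 set $B$ with $m(\psi_t(B)\triangle B)=0$ for all $t\in\mathbb R$ satisfies $m(B)=0$ or $m(B^c)=0$. It has infinite ergodic index if for every integer $L\ge1$ the $L$-fold product $\psi_t\times\cdots\times\psi_t$ is ergodic with respect to $m\times\cdots\times m$. *)

theory Defs
  imports "HOL-Analysis.Analysis"
begin

text \<open>The plane is the type \<^typ>\<open>complex\<close>, and the circle of directions is the unit circle in
  \<^typ>\<open>complex\<close>: the angle \<open>\<alpha>\<close> is represented by \<^term>\<open>cis \<alpha>\<close>.\<close>

definition l1_dist :: "complex \<Rightarrow> complex \<Rightarrow> real" where
  "l1_dist z w = \<bar>Re z - Re w\<bar> + \<bar>Im z - Im w\<bar>"

definition Conf :: "real \<Rightarrow> complex set set" where
  "Conf s = {g. countable g \<and> (\<forall>z1\<in>g. \<forall>z2\<in>g. z1 \<noteq> z2 \<longrightarrow> l1_dist z1 z2 \<ge> s)}"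

text \<open>The unit sphere of Euclidean 3-space is \<^term>\<open>sphere (0 :: complex \<times> real) 1\<close>.  The case
  \<open>z = 0\<close> is the limit of \<open>2 * arctan (1 / r)\<close> as \<open>r\<close> tends to 0, which differs from its value
  under the convention \<open>1 / 0 = 0\<close>.\<close>

definition north_pole :: "complex \<times> real" where
  "north_pole = (0, 1)"

definition inv_stereographic :: "complex \<Rightarrow> complex \<times> real" where
  "inv_stereographic z =
     (let \<phi> = (if z = 0 then pi else 2 * arctan (1 / cmod z))
      in (of_real (sin \<phi>) * cis (Arg z), cos \<phi>))"

definition compactify :: "complex set \<Rightarrow> (complex \<times> real) set" where
  "compactify g = insert north_pole (inv_stereographic ` g)"

definition geodesic_dist :: "complex \<times> real \<Rightarrow> complex \<times> real \<Rightarrow> real" where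
  "geodesic_dist p q = arccos (p \<bullet> q)"

definition hausdorff_dist :: "('a \<Rightarrow> 'a \<Rightarrow> real) \<Rightarrow> 'a set \<Rightarrow> 'a set \<Rightarrow> real" where
  "hausdorff_dist d A B = max (SUP a\<in>A. INF b\<in>B. d a b) (SUP b\<in>B. INF a\<in>A. d a b)"

definition conf_dist :: "complex set \<Rightarrow> complex set \<Rightarrow> real" where
  "conf_dist g1 g2 = hausdorff_dist geodesic_dist (compactify g1) (compactify g2)"

definition conf_topology :: "real \<Rightarrow> complex set topology" where
  "conf_topology s = Metric_space.mtopology (Conf s) conf_dist"

definition dense_gdelta_in :: "'a topology \<Rightarrow> 'a set \<Rightarrow> bool" where
  "dense_gdelta_in X S \<longleftrightarrow> gdelta_in X S \<and> X closure_of S = topspace X"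

definition circle :: "complex set" where
  "circle = sphere 0 1"

text \<open>Since \<^term>\<open>cis\<close> is periodic, this says that \<open>circle - H\<close> has arc length 0.\<close>

definition full_measure_on_circle :: "complex set \<Rightarrow> bool" where
  "full_measure_on_circle H \<longleftrightarrow> (AE \<alpha> in lborel. cis \<alpha> \<in> H)"

type_synonym state = "complex \<times> complex"

definition tree :: "real \<Rightarrow> complex \<Rightarrow> complex set" where
  "tree s z = {w. l1_dist w z \<le> s / 2}"

definition corners :: "real \<Rightarrow> complex \<Rightarrow> complex set" where
  "corners s z = {z + of_real (s/2), z - of_real (s/2), z + \<i> * of_real (s/2), z - \<i> * of_real (s/2)}"

definition table :: "real \<Rightarrow> complex set \<Rightarrow> complex set" where
  "table s g = UNIV - (\<Union>z\<in>g. interior (tree s z))"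

text \<open>The directions \<open>\<theta>\<close>, \<open>-\<theta>\<close>, \<open>\<pi> - \<theta>\<close> and \<open>-(\<pi> - \<theta>)\<close>, as points of the unit circle.\<close>

definition directions :: "complex \<Rightarrow> complex set" where
  "directions \<theta> = {\<theta>, cnj \<theta>, - cnj \<theta>, - \<theta>}"

text \<open>Angles are measured from the side direction \<open>y = x\<close>, hence the rotation by \<open>\<pi>/4\<close>.\<close>

definition velocity :: "complex \<Rightarrow> complex" where
  "velocity u = u * cis (pi / 4)"

text \<open>Reflection of a direction in the side, through the boundary point \<open>p\<close>, of the tree centred
  at \<open>z\<close>.  The sides parallel to \<open>y = x\<close> are those in the second and fourth quadrant seen from \<open>z\<close>;
  reflection in them is \<open>\<alpha> \<mapsto> -\<alpha>\<close>, and reflection in the other two is \<open>\<alpha> \<mapsto> \<pi> - \<alpha>\<close>.\<close>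

definition reflect :: "complex \<Rightarrow> complex \<Rightarrow> complex \<Rightarrow> complex" where
  "reflect z p u = (if Re (p - z) * Im (p - z) < 0 then cnj u else - cnj u)"

text \<open>Orbits parametrised by the time interval \<open>I\<close>.  At the time of a collision the state carries
  the velocity after the collision.\<close>

definition billiard_orbit :: "real \<Rightarrow> complex set \<Rightarrow> complex \<Rightarrow> real set \<Rightarrow> (real \<Rightarrow> state) \<Rightarrow> bool" where
  "billiard_orbit s g \<theta> I \<gamma> \<longleftrightarrow>
     (\<forall>t\<in>I. \<exists>p u. \<gamma> t = (p, u) \<and>
        p \<in> table s g \<and> u \<in> directions \<theta> \<and>
        (\<forall>z\<in>g. p \<notin> corners s z) \<and>
        (p \<in> interior (table s g) \<longrightarrow>
           (\<exists>\<epsilon>>0. \<forall>\<tau>\<in>I. \<bar>\<tau> - t\<bar> < \<epsilon> \<longrightarrow> \<gamma> \<tau> = (p + of_real (\<tau> - t) * velocity u, u))) \<and>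
        (\<forall>z\<in>g. p \<in> frontier (tree s z) \<longrightarrow>
           (let u' = reflect z p u in
            \<exists>\<epsilon>>0. \<forall>\<tau>\<in>I.
              (t \<le> \<tau> \<and> \<tau> < t + \<epsilon> \<longrightarrow> \<gamma> \<tau> = (p + of_real (\<tau> - t) * velocity u, u)) \<and>
              (t - \<epsilon> < \<tau> \<and> \<tau> < t \<longrightarrow> \<gamma> \<tau> = (p + of_real (\<tau> - t) * velocity u', u')))))"

text \<open>For a state of the table, the value \<^const>\<open>None\<close> means that the orbit meets a corner between
  the times 0 and \<open>t\<close>, or that the state is on the boundary with direction pointing into a tree.\<close>

definition billiard_flow :: "real \<Rightarrow> complex set \<Rightarrow> complex \<Rightarrow> real \<Rightarrow> state \<rightharpoonup> state" where
  "billiard_flow s g \<theta> t x =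
     (if \<exists>\<gamma>. billiard_orbit s g \<theta> (closed_segment 0 t) \<gamma> \<and> \<gamma> 0 = x
      then Some (THE y. \<exists>\<gamma>. billiard_orbit s g \<theta> (closed_segment 0 t) \<gamma> \<and> \<gamma> 0 = x \<and> \<gamma> t = y)
      else None)"

text \<open>The corner states, and the boundary states whose direction points into a tree, belong to the
  space of this measure, but the flow is not defined on them for any time other than 0; they
  form a null set.\<close>

definition phase_measure :: "real \<Rightarrow> complex set \<Rightarrow> complex \<Rightarrow> state measure" where
  "phase_measure s g \<theta> = restrict_space lborel (table s g) \<Otimes>\<^sub>M count_space (directions \<theta>)"

text \<open>A partial flow takes the value \<^const>\<open>None\<close> where it is not defined; images are taken over the
  points where it is defined.\<close>

definition flow_image :: "(real \<Rightarrow> 'a \<rightharpoonup> 'a) \<Rightarrow> real \<Rightarrow> 'a set \<Rightarrow> 'a set" where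
  "flow_image \<psi> t B = {y. \<exists>x\<in>B. \<psi> t x = Some y}"

definition measure_preserving_flow :: "'a measure \<Rightarrow> (real \<Rightarrow> 'a \<rightharpoonup> 'a) \<Rightarrow> bool" where
  "measure_preserving_flow m \<psi> \<longleftrightarrow>
     (\<forall>t. \<forall>B\<in>sets m. flow_image \<psi> t B \<in> sets m \<and> emeasure m (flow_image \<psi> t B) = emeasure m B)"

text \<open>Ergodicity is a notion for flows that preserve the measure.  Nullity is expressed by
  \<^const>\<open>null_sets\<close> because \<^const>\<open>emeasure\<close> vanishes on all non-measurable sets.\<close>

definition ergodic_flow :: "'a measure \<Rightarrow> (real \<Rightarrow> 'a \<rightharpoonup> 'a) \<Rightarrow> bool" where
  "ergodic_flow m \<psi> \<longleftrightarrow>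
     measure_preserving_flow m \<psi> \<and>
     (\<forall>B\<in>sets m. (\<forall>t. sym_diff (flow_image \<psi> t B) B \<in> null_sets m) \<longrightarrow>
        B \<in> null_sets m \<or> space m - B \<in> null_sets m)"

definition power_measure :: "nat \<Rightarrow> 'a measure \<Rightarrow> (nat \<Rightarrow> 'a) measure" where
  "power_measure L m = PiM {..<L} (\<lambda>_. m)"

definition power_flow :: "nat \<Rightarrow> (real \<Rightarrow> 'a \<rightharpoonup> 'a) \<Rightarrow> real \<Rightarrow> (nat \<Rightarrow> 'a) \<rightharpoonup> (nat \<Rightarrow> 'a)" where
  "power_flow L \<psi> t x =
     (if \<forall>k<L. \<psi> t (x k) \<noteq> None then Some (\<lambda>k\<in>{..<L}. the (\<psi> t (x k))) else None)"

definition infinite_ergodic_index :: "'a measure \<Rightarrow> (real \<Rightarrow> 'a \<rightharpoonup> 'a) \<Rightarrow> bool" where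
  "infinite_ergodic_index m \<psi> \<longleftrightarrow> (\<forall>L\<ge>1. ergodic_flow (power_measure L m) (power_flow L \<psi>))"

definition f_hat :: "nat \<Rightarrow> complex \<Rightarrow> (nat \<Rightarrow> state) \<Rightarrow> real" where
  "f_hat K i x = (\<Sum>k | k < K \<and> snd (x k) = i. 1 / max 1 (cmod (fst (x k)) ^ 3))"

end

theory Submission
  imports Defs
begin

text \<open>For \<open>K \<ge> 2\<close> the function \<open>f_hat\<close> is in general not integrable, so a ratio ergodic theorem cannot be applied to
  the product flow.  But its orbit integral is the sum over the particles of the orbit integrals of
  the one-particle function \<open>1 / max 1 \<bar>z\<bar>\<^sup>3\<close> restricted to a direction, which is integrable with an integral
  independent of the direction.  It therefore suffices that the one-particle integrals diverge and
  that their ratios tend to 1, and for this only the ergodicity of the flow itself is used.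

  Divergence: almost every orbit visits every small ball and crosses it at unit speed.  A grid of
  \<open>N\<^sup>2\<close> balls of radius of order \<open>1/N\<close> thus costs time of order \<open>N\<close>, so the integral over the two-sided
  orbit is infinite.  Where the future integral were finite, a wandering-set argument would make the
  past integral finite as well.

  Ratio: for \<open>c > 1\<close> the set of points where the orbit integral of \<open>f - c g\<close> is unbounded above is
  invariant.  If it had full measure, the maximal ergodic theorem would give \<open>\<integral> f - c g \<ge> 0\<close>, which is
  false when \<open>\<integral> f = \<integral> g > 0\<close>.\<close>

section \<open>Ergodic flows on infinite measure spaces\<close>

text \<open>Two obstacles shape the proof. Divergence does not follow from ergodicity alone:
  translation on the line is ergodic, yet orbit integrals of integrable functions converge. It is
  the second dimension of the table that helps, since \<open>N^2\<close> crossings of length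
  \<open>1/N\<close> add up to infinity, where \<open>N\<close> crossings on a line would not.
  Moreover the given flow is partial, with preservation and invariance stated through images, and
  joint measurability in time and state is not given. Preservation repairs the first point: the set
  on which a time map is undefined has empty image, hence measure 0. Discarding all states without a
  two-sided orbit leaves a true group of measure-preserving maps on a measurable set of full
  measure. Joint measurability comes from right continuity in time.\<close>

lemma maximal_ergodic:
  fixes F :: "'a \<Rightarrow> real"
  assumes T[measurable]: "T \<in> M \<rightarrow>\<^sub>M M" and inv: "distr M M T = M"
    and F: "integrable M F"
    and pos: "AE x in M. \<exists>n. (\<Sum>k<n. F ((T ^^ k) x)) > 0"
  shows "integral\<^sup>L M F \<ge> 0"
proof -
  \<comment> \<open>\<open>m n\<close> is the maximum of the Birkhoff sums of lengths 0 to
    \<open>n\<close>, in the recursive form of Garsia's proof. The recursion keeps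
    \<open>m n\<close> integrable, so \<open>m n x - m n (T x)\<close> integrates to 0 even on a
    space of infinite measure.\<close>
  define m where "m = rec_nat (\<lambda>x. 0) (\<lambda>_ r x. max 0 (F x + r (T x)))"
  have m0: "m 0 x = 0" and mSuc: "m (Suc n) x = max 0 (F x + m n (T x))" for n x
    by (simp_all add: m_def)
  have int_T: "integrable M (\<lambda>x. h (T x))" "(\<integral>x. h (T x) \<partial>M) = integral\<^sup>L M h"
    if "integrable M h" for h :: "'a \<Rightarrow> real"
  proof -
    have [measurable]: "h \<in> borel_measurable M" using that by auto
    show "integrable M (\<lambda>x. h (T x))" using that integrable_distr[OF T, of h] inv by simp
    show "(\<integral>x. h (T x) \<partial>M) = integral\<^sup>L M h" using integral_distr[OF T, of h] inv by simp
  qed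
  have m_int: "integrable M (m n)" for n
  proof (induction n)
    case 0
    have "m 0 = (\<lambda>x. 0)" using m0 by auto
    then show ?case by simp
  next
    case (Suc n)
    have "m (Suc n) = (\<lambda>x. max 0 (F x + m n (T x)))" using mSuc by auto
    then show ?case using F int_T(1)[OF Suc] by auto
  qed
  have m_nonneg: "m n x \<ge> 0" for n x by (cases n) (auto simp: m0 mSuc)
  have m_step: "m n x \<le> m (Suc n) x" for n x
  proof (induction n arbitrary: x)
    case 0 then show ?case by (simp add: m0 m_nonneg)
  next
    case (Suc n) show ?case using Suc[of "T x"] unfolding mSuc[of "Suc n" x] mSuc[of n x] by (intro max.mono) auto
  qed
  have m_mono: "m a x \<le> m b x" if "a \<le> b" for a b x
    using lift_Suc_mono_le[of "\<lambda>n. m n x"] m_step that by auto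
  have m_ge: "(\<Sum>k<n. F ((T ^^ k) x)) \<le> m n x" for n x
  proof (induction n arbitrary: x)
    case 0 then show ?case by (simp add: m0)
  next
    case (Suc n)
    have "(\<Sum>k<Suc n. F ((T ^^ k) x)) = F x + (\<Sum>k<n. F ((T ^^ k) (T x)))"
      by (subst sum.lessThan_Suc_shift) (simp add: funpow_swap1)
    also have "\<dots> \<le> m (Suc n) x" using Suc[of "T x"] by (simp add: mSuc)
    finally show ?case .
  qed
  define G where "G n x = (if m n x > 0 then F x else 0)" for n x
  have [measurable]: "F \<in> borel_measurable M" "m n \<in> borel_measurable M" for n
    using F m_int by auto
  have G_meas[measurable]: "G n \<in> borel_measurable M" for n
    unfolding G_def by measurable
  have G_int: "integrable M (G n)" for n
    by (rule Bochner_Integration.integrable_bound[OF F]) (auto simp: G_def)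
  \<comment> \<open>Where \<open>m n x > 0\<close>, the recursion gives
    \<open>F x + m (n - 1) (T x)\<close>, and replacing \<open>n - 1\<close> by \<open>n\<close>
    only increases this. Elsewhere the left side is at most 0.\<close>
  have G_ge: "m n x - m n (T x) \<le> G n x" for n x
  proof (cases n)
    case 0 then show ?thesis by (simp add: m0 G_def)
  next
    case (Suc k)
    then show ?thesis using m_step[of k "T x"] m_nonneg[of n "T x"]
      by (auto simp: G_def mSuc max_def split: if_splits)
  qed
  have G_nonneg: "integral\<^sup>L M (G n) \<ge> 0" for n
  proof -
    have "0 = (\<integral>x. m n x - m n (T x) \<partial>M)"
      using int_T[OF m_int] m_int by simp
    also have "\<dots> \<le> integral\<^sup>L M (G n)"
      using int_T(1)[OF m_int] m_int G_int G_ge by (intro integral_mono) auto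
    finally show ?thesis .
  qed
  \<comment> \<open>By \<open>pos\<close>, the increasing sets on which \<open>m n > 0\<close>
    exhaust almost all of the space.\<close>
  have "(\<lambda>n. integral\<^sup>L M (G n)) \<longlonglongrightarrow> integral\<^sup>L M F"
  proof (rule integral_dominated_convergence[where w = "\<lambda>x. norm (F x)"])
    show "AE x in M. (\<lambda>n. G n x) \<longlonglongrightarrow> F x"
      using pos
    proof eventually_elim
      case (elim x)
      then obtain n where "(\<Sum>k<n. F ((T ^^ k) x)) > 0" by auto
      then have "m k x > 0" if "k \<ge> n" for k
        using m_ge[where n=n and x=x] m_mono[OF that, of x] by linarith
      then have "eventually (\<lambda>k. G k x = F x) sequentially"
        unfolding eventually_sequentially G_def by auto
      then show ?case by (rule tendsto_eventually)
    qed
  qed (use F in \<open>auto simp: G_def\<close>)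
  then show ?thesis using G_nonneg by (intro LIMSEQ_le_const) auto
qed

text \<open>Ergodicity is demanded only for sets that every time map carries into themselves
  exactly. The test sets used below are built to be invariant in this strict sense, so exceptional
  null sets depending on the time never have to be handled.\<close>

locale ergodic_measurable_flow = sigma_finite_measure M
  for M :: "'a measure" and \<phi> :: "real \<Rightarrow> 'a \<Rightarrow> 'a" +
  assumes flow_measurable[measurable]: "\<And>t. \<phi> t \<in> M \<rightarrow>\<^sub>M M"
    and distr_flow: "\<And>t. distr M M (\<phi> t) = M"
    and flow_add: "\<And>x s t. x \<in> space M \<Longrightarrow> \<phi> s (\<phi> t x) = \<phi> (s + t) x"
    and flow_0: "\<And>x. x \<in> space M \<Longrightarrow> \<phi> 0 x = x"
    and ergodic: "\<And>B. B \<in> sets M \<Longrightarrow> (\<And>t x. x \<in> B \<Longrightarrow> \<phi> t x \<in> B) \<Longrightarrow>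
      B \<in> null_sets M \<or> space M - B \<in> null_sets M"
begin

lemma flow_space: "x \<in> space M \<Longrightarrow> \<phi> t x \<in> space M"
  using flow_measurable measurable_space by metis

lemma flow_neg: "x \<in> space M \<Longrightarrow> \<phi> (- t) (\<phi> t x) = x" "x \<in> space M \<Longrightarrow> \<phi> t (\<phi> (- t) x) = x"
  using flow_add flow_0 by auto

lemma flow_funpow: "x \<in> space M \<Longrightarrow> (\<phi> 1 ^^ n) x = \<phi> (real n) x"
  by (induction n) (auto simp: flow_0 flow_add)

lemma nn_integral_flow:
  assumes [measurable]: "h \<in> borel_measurable M"
  shows "(\<integral>\<^sup>+x. h (\<phi> t x) \<partial>M) = (\<integral>\<^sup>+x. h x \<partial>M)"
  using nn_integral_distr[of "\<phi> t" M M h] distr_flow by simp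

lemma AE_flow:
  assumes "AE x in M. P x"
  shows "AE x in M. P (\<phi> t x)"
proof -
  have "AE x in distr M M (\<phi> t). P x" unfolding distr_flow by (rule assms)
  then show ?thesis by (rule AE_distrD[OF flow_measurable])
qed

text \<open>Joint measurability is asked of the composition with the flow, which is all that Fubini
  needs. The bound 1 makes the occupation of a set of times at most its length.\<close>

definition observable :: "('a \<Rightarrow> real) \<Rightarrow> bool" where
  "observable f \<longleftrightarrow> integrable M f \<and> (\<forall>x. 0 \<le> f x \<and> f x \<le> 1) \<and>
     (\<lambda>(t, x). f (\<phi> t x)) \<in> borel_measurable (lborel \<Otimes>\<^sub>M M)"

definition occ :: "('a \<Rightarrow> real) \<Rightarrow> 'a \<Rightarrow> real measure" where
  "occ f x = density lborel (\<lambda>t. ennreal (f (\<phi> t x)))"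

lemma sets_occ[simp, measurable_cong]: "sets (occ f x) = sets borel" by (simp add: occ_def)
lemma space_occ[simp]: "space (occ f x) = UNIV" by (simp add: occ_def)

section \<open>Occupation measures along orbits\<close>

context
  fixes f assumes f: "observable f"
begin

lemma obs_nonneg: "0 \<le> f x" and obs_le1: "f x \<le> 1" and obs_integrable: "integrable M f"
  using f by (auto simp: observable_def)

lemma obs_measurable[measurable]: "f \<in> borel_measurable M"
  using obs_integrable by auto

lemma obs_joint[measurable]: "(\<lambda>(t, x). f (\<phi> t x)) \<in> borel_measurable (lborel \<Otimes>\<^sub>M M)"
  using f by (auto simp: observable_def)

lemma obs_joint_fst_snd[measurable]: "(\<lambda>p. f (\<phi> (fst p) (snd p))) \<in> borel_measurable (lborel \<Otimes>\<^sub>M M)"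
  using obs_joint by (simp add: case_prod_beta')

lemma obs_joint_swap[measurable]: "(\<lambda>p. f (\<phi> (snd p) (fst p))) \<in> borel_measurable (M \<Otimes>\<^sub>M lborel)"
proof -
  have "(\<lambda>p. (snd p, fst p)) \<in> M \<Otimes>\<^sub>M lborel \<rightarrow>\<^sub>M lborel \<Otimes>\<^sub>M M" by measurable
  from measurable_compose[OF this obs_joint_fst_snd] show ?thesis by simp
qed

lemma obs_time_measurable:
  assumes "x \<in> space M"
  shows "(\<lambda>t. f (\<phi> t x)) \<in> borel_measurable borel"
proof -
  have "(\<lambda>t. (t, x)) \<in> lborel \<rightarrow>\<^sub>M lborel \<Otimes>\<^sub>M M" using assms by measurable
  from measurable_compose[OF this obs_joint] show ?thesis by simp
qed

lemma emeasure_occ: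
  assumes "x \<in> space M" "A \<in> sets borel"
  shows "emeasure (occ f x) A = (\<integral>\<^sup>+t. ennreal (f (\<phi> t x)) * indicator A t \<partial>lborel)"
  unfolding occ_def using obs_time_measurable[OF assms(1)] assms(2)
  by (intro emeasure_density) auto

lemma emeasure_occ_le:
  assumes "x \<in> space M" "A \<in> sets borel"
  shows "emeasure (occ f x) A \<le> emeasure lborel A"
proof -
  have "emeasure (occ f x) A \<le> (\<integral>\<^sup>+t. indicator A t \<partial>lborel)"
    unfolding emeasure_occ[OF assms] using obs_le1
    by (intro nn_integral_mono) (auto simp: indicator_def)
  then show ?thesis using assms by simp
qed

lemma emeasure_occ_measurable[measurable]:
  assumes [measurable]: "A \<in> sets borel"
  shows "(\<lambda>x. emeasure (occ f x) A) \<in> borel_measurable M"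
proof -
  have "(\<lambda>x. \<integral>\<^sup>+t. ennreal (f (\<phi> t x)) * indicator A t \<partial>lborel) \<in> borel_measurable M"
    by (rule sigma_finite_measure.borel_measurable_nn_integral[OF sigma_finite_lborel])
      (simp add: case_prod_beta')
  then show ?thesis
    by (rule measurable_cong[THEN iffD1, rotated]) (simp add: emeasure_occ)
qed

lemma emeasure_occ_flow:
  assumes x: "x \<in> space M" and A: "A \<in> sets borel"
  shows "emeasure (occ f (\<phi> a x)) ((\<lambda>t. t + a) -` A) = emeasure (occ f x) A"
proof -
  have [measurable]: "(\<lambda>t. f (\<phi> t x)) \<in> borel_measurable borel" "A \<in> sets borel"
    using obs_time_measurable x A by auto
  have "emeasure (occ f x) A = (\<integral>\<^sup>+t. ennreal (f (\<phi> t x)) * indicator A t \<partial>lborel)"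
    using emeasure_occ x A by simp
  also have "\<dots> = (\<integral>\<^sup>+t. ennreal (f (\<phi> (a + t) x)) * indicator A (a + t) \<partial>lborel)"
    by (subst nn_integral_real_affine[where c=1 and t=a]) auto
  also have "\<dots> = (\<integral>\<^sup>+t. ennreal (f (\<phi> t (\<phi> a x))) * indicator ((\<lambda>t. t + a) -` A) t \<partial>lborel)"
    using x by (intro nn_integral_cong) (auto simp: flow_add add.commute indicator_def)
  also have "\<dots> = emeasure (occ f (\<phi> a x)) ((\<lambda>t. t + a) -` A)"
    using emeasure_occ[OF flow_space[OF x], of "(\<lambda>t. t + a) -` A" a] measurable_sets[of "\<lambda>t. t + a" borel borel A]
    by auto
  finally show ?thesis by simp
qed

text \<open>Fubini exchanges time and space, and by invariance the space integral is the same at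
  every time.\<close>

lemma nn_integral_occ:
  assumes [measurable]: "A \<in> sets borel"
  shows "(\<integral>\<^sup>+x. emeasure (occ f x) A \<partial>M) = emeasure lborel A * (\<integral>\<^sup>+x. f x \<partial>M)"
proof -
  interpret L: pair_sigma_finite lborel M ..
  have "(\<integral>\<^sup>+x. emeasure (occ f x) A \<partial>M) = (\<integral>\<^sup>+x. \<integral>\<^sup>+t. ennreal (f (\<phi> t x)) * indicator A t \<partial>lborel \<partial>M)"
    by (intro nn_integral_cong) (simp add: emeasure_occ)
  also have "\<dots> = (\<integral>\<^sup>+t. \<integral>\<^sup>+x. ennreal (f (\<phi> t x)) * indicator A t \<partial>M \<partial>lborel)"
    by (rule L.Fubini') (simp add: case_prod_beta')
  also have "\<dots> = (\<integral>\<^sup>+t. (\<integral>\<^sup>+x. f x \<partial>M) * indicator A t \<partial>lborel)"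
    by (intro nn_integral_cong) (simp add: nn_integral_multc nn_integral_flow[of "\<lambda>x. ennreal (f x)"])
  also have "\<dots> = emeasure lborel A * (\<integral>\<^sup>+x. f x \<partial>M)"
    by (subst nn_integral_cmult) (auto simp: mult.commute)
  finally show ?thesis .
qed

section \<open>Unit time windows, past and future occupation\<close>

lemma emeasure_occ_flow_Ico:
  assumes "x \<in> space M"
  shows "emeasure (occ f (\<phi> a x)) {c..<d} = emeasure (occ f x) {c + a..<d + a}"
proof -
  have "(\<lambda>t. t + a) -` {c + a..<d + a} = {c..<d}" by auto
  then show ?thesis using emeasure_occ_flow[OF assms, of "{c + a..<d + a}" a] by simp
qed

lemma emeasure_occ_flow_Ici:
  assumes "x \<in> space M"
  shows "emeasure (occ f (\<phi> a x)) {c..} = emeasure (occ f x) {c + a..}"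
proof -
  have "(\<lambda>t. t + a) -` {c + a..} = {c..}" by auto
  then show ?thesis using emeasure_occ_flow[OF assms, of "{c + a..}" a] by simp
qed

lemma emeasure_occ_Ici:
  assumes "x \<in> space M"
  shows "(\<Sum>n. emeasure (occ f (\<phi> (real n) x)) {0..<1}) = emeasure (occ f x) {0..}"
proof -
  have U: "(\<Union>n. {real n..<1 + real n}) = {0..}"
  proof (intro set_eqI iffI)
    fix t :: real assume "t \<in> {0..}"
    then have "t \<in> {real (nat \<lfloor>t\<rfloor>)..<1 + real (nat \<lfloor>t\<rfloor>)}" by (simp, linarith)
    then show "t \<in> (\<Union>n. {real n..<1 + real n})" by blast
  qed auto
  have "disjoint_family (\<lambda>n. {real n..<1 + real n})"
  proof -
    have "m = n" if "t \<in> {real m..<1 + real m}" "t \<in> {real n..<1 + real n}" for t m n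
      using that by auto
    then show ?thesis unfolding disjoint_family_on_def by blast
  qed
  then have "(\<Sum>n. emeasure (occ f x) {real n..<1 + real n}) = emeasure (occ f x) {0..}"
    unfolding U[symmetric] by (intro suminf_emeasure) auto
  then show ?thesis using assms by (simp add: emeasure_occ_flow_Ico)
qed

lemma emeasure_occ_Iio:
  assumes "x \<in> space M"
  shows "(\<Sum>n. emeasure (occ f (\<phi> (- real (Suc n)) x)) {0..<1}) = emeasure (occ f x) {..<0}"
proof -
  let ?A = "\<lambda>n. {0 + - real (Suc n)..<1 + - real (Suc n)}"
  have U: "(\<Union>n. ?A n) = {..<0}"
  proof (intro set_eqI iffI)
    fix t :: real assume "t \<in> {..<0}"
    then have "t \<in> ?A (nat (- \<lfloor>t\<rfloor> - 1))" by (simp, linarith)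
    then show "t \<in> (\<Union>n. ?A n)" by blast
  qed auto
  have "disjoint_family ?A"
  proof -
    have "m = n" if "t \<in> ?A m" "t \<in> ?A n" for t m n
      using that by auto
    then show ?thesis unfolding disjoint_family_on_def by blast
  qed
  then have "(\<Sum>n. emeasure (occ f x) (?A n)) = emeasure (occ f x) {..<0}"
    unfolding U[symmetric] by (intro suminf_emeasure) auto
  then show ?thesis using assms by (simp only: emeasure_occ_flow_Ico)
qed

text \<open>All weights vanish before the first integer time \<open>m\<close> at which the future
  occupation is at most \<open>c\<close>. From then on the weights are bounded by the occupations of
  unit windows that tile the future of the state at time \<open>m\<close>, so their sum is at most
  \<open>c\<close>.\<close>

lemma sum_weight_le:
  fixes c :: nat
  assumes x: "x \<in> space M"
  defines "w \<equiv> \<lambda>x. emeasure (occ f x) {0..<1} * indicator {x. emeasure (occ f x) {0..} \<le> of_nat c} x"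
  shows "(\<Sum>n. w (\<phi> (real n) x)) \<le> of_nat c"
proof (cases "\<exists>n. emeasure (occ f (\<phi> (real n) x)) {0..} \<le> of_nat c")
  case False
  then show ?thesis by (simp add: w_def)
next
  case True
  define m where "m = (LEAST n. emeasure (occ f (\<phi> (real n) x)) {0..} \<le> of_nat c)"
  have m: "emeasure (occ f (\<phi> (real m) x)) {0..} \<le> of_nat c"
    unfolding m_def by (rule LeastI_ex[OF True])
  have less: "w (\<phi> (real n) x) = 0" if "n < m" for n
    using not_less_Least[of n] that unfolding w_def m_def by (metis indicator_simps(2) mem_Collect_eq mult_zero_right)
  have "(\<Sum>n. w (\<phi> (real n) x)) = (\<Sum>n. w (\<phi> (real (n + m)) x))"
    using suminf_offset[of "\<lambda>n. w (\<phi> (real n) x)" m] less by (simp add: summableI)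
  also have "\<dots> \<le> (\<Sum>n. emeasure (occ f (\<phi> (real n) (\<phi> (real m) x))) {0..<1})"
    using x by (intro suminf_le summableI) (auto simp: w_def flow_add indicator_def)
  also have "\<dots> \<le> of_nat c" using m x by (simp add: emeasure_occ_Ici flow_space)
  finally show ?thesis .
qed

text \<open>Weighting the past occupation by the present one restricted to states of small future
  occupation, invariance moves the weight to the future, where it telescopes.\<close>

lemma AE_past_finite:
  "AE x in M. emeasure (occ f x) {0..<1} > 0 \<longrightarrow> emeasure (occ f x) {0..} < \<infinity> \<longrightarrow>
     emeasure (occ f x) {..<0} < \<infinity>"
proof -
  let ?F = "\<lambda>x. emeasure (occ f x) {0..<1}"
  define w where "w c x = ?F x * indicator {x. emeasure (occ f x) {0..} \<le> of_nat c} x" for c :: nat and x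
  have [measurable]: "w c \<in> borel_measurable M" for c
    unfolding w_def by measurable
  \<comment> \<open>The integral is bounded by \<open>c\<close> times the integral of
    \<open>f\<close>, which is finite for each fixed \<open>c\<close> only. Countably many
    \<open>c\<close> cover all states of finite future occupation.\<close>
  have "AE x in M. w c x * emeasure (occ f x) {..<0} \<noteq> \<infinity>" for c
  proof (rule nn_integral_PInf_AE)
    have "(\<integral>\<^sup>+x. w c x * emeasure (occ f x) {..<0} \<partial>M)
      = (\<integral>\<^sup>+x. (\<Sum>n. w c x * ?F (\<phi> (- real (Suc n)) x)) \<partial>M)"
      by (intro nn_integral_cong) (simp only: emeasure_occ_Iio[symmetric] ennreal_suminf_cmult)
    also have "\<dots> = (\<Sum>n. \<integral>\<^sup>+x. w c x * ?F (\<phi> (- real (Suc n)) x) \<partial>M)"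
      by (intro nn_integral_suminf) measurable
    also have "\<dots> = (\<Sum>n. \<integral>\<^sup>+x. w c (\<phi> (real (Suc n)) x) * ?F x \<partial>M)"
    proof (intro suminf_cong)
      fix n
      have "(\<integral>\<^sup>+x. w c x * ?F (\<phi> (- real (Suc n)) x) \<partial>M) =
        (\<integral>\<^sup>+x. w c (\<phi> (real (Suc n)) x) * ?F (\<phi> (- real (Suc n)) (\<phi> (real (Suc n)) x)) \<partial>M)"
        by (rule nn_integral_flow[symmetric]) measurable
      also have "\<dots> = (\<integral>\<^sup>+x. w c (\<phi> (real (Suc n)) x) * ?F x \<partial>M)"
        by (intro nn_integral_cong) (simp only: flow_neg)
      finally show "(\<integral>\<^sup>+x. w c x * ?F (\<phi> (- real (Suc n)) x) \<partial>M) =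
        (\<integral>\<^sup>+x. w c (\<phi> (real (Suc n)) x) * ?F x \<partial>M)" .
    qed
    also have "\<dots> = (\<integral>\<^sup>+x. (\<Sum>n. w c (\<phi> (real (Suc n)) x) * ?F x) \<partial>M)"
      by (intro nn_integral_suminf[symmetric]) measurable
    also have "\<dots> \<le> (\<integral>\<^sup>+x. of_nat c * ?F x \<partial>M)"
    proof (intro nn_integral_mono)
      fix x assume x: "x \<in> space M"
      have "(\<Sum>n. w c (\<phi> (real (Suc n)) x)) \<le> (\<Sum>n. w c (\<phi> (real n) x))"
        using suminf_offset[of "\<lambda>n. w c (\<phi> (real n) x)" 1] by (simp add: summableI)
      also have "\<dots> \<le> of_nat c" using sum_weight_le[OF x] by (simp add: w_def)
      finally show "(\<Sum>n. w c (\<phi> (real (Suc n)) x) * ?F x) \<le> of_nat c * ?F x"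
        unfolding ennreal_suminf_multc by (intro mult_right_mono) auto
    qed
    also have "\<dots> = of_nat c * (\<integral>\<^sup>+x. f x \<partial>M)"
      by (subst nn_integral_cmult) (auto simp: nn_integral_occ)
    also have "\<dots> < \<infinity>"
      using obs_integrable obs_nonneg by (simp add: ennreal_mult_less_top nn_integral_eq_integral of_nat_less_top)
    finally show "(\<integral>\<^sup>+x. w c x * emeasure (occ f x) {..<0} \<partial>M) \<noteq> \<infinity>" by simp
  qed measurable
  then have "AE x in M. \<forall>c. w c x * emeasure (occ f x) {..<0} \<noteq> \<infinity>"
    by (simp add: AE_all_countable)
  then show ?thesis
  proof eventually_elim
    case (elim x)
    show ?case
    proof (intro impI)
      assume F: "?F x > 0" and "emeasure (occ f x) {0..} < \<infinity>"
      then obtain c :: nat where "emeasure (occ f x) {0..} \<le> of_nat c"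
        using ennreal_Ex_less_of_nat[of "emeasure (occ f x) {0..}"] less_imp_le by fastforce
      then have "w c x = ?F x" by (simp add: w_def)
      then show "emeasure (occ f x) {..<0} < \<infinity>"
        using elim F by (metis ennreal_mult_eq_top_iff infinity_ennreal_def less_irrefl top.not_eq_extremum)
    qed
  qed
qed

text \<open>The futures of two states on one orbit differ by a bounded time interval, whose
  occupation is at most its length.\<close>

lemma emeasure_occ_Ici_flow_infinite:
  assumes x: "x \<in> space M" and inf: "emeasure (occ f (\<phi> a x)) {0..} = \<infinity>"
  shows "emeasure (occ f x) {0..} = \<infinity>"
proof -
  have "emeasure (occ f x) {a..} \<le> emeasure (occ f x) ({0..} \<union> {a..<0})"
    by (intro emeasure_mono) auto
  also have "\<dots> \<le> emeasure (occ f x) {0..} + emeasure (occ f x) {a..<0}"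
    by (intro emeasure_subadditive) auto
  also have "emeasure (occ f x) {a..<0} \<le> emeasure lborel {a..<0}"
    by (rule emeasure_occ_le[OF x]) auto
  finally have "\<infinity> \<le> emeasure (occ f x) {0..} + emeasure lborel {a..<0}"
    using inf emeasure_occ_flow_Ici[OF x, of a 0] by simp
  moreover have "emeasure lborel {a..<0} < \<infinity>" by (cases "a \<le> 0") auto
  ultimately show ?thesis by (auto simp: top_unique)
qed

text \<open>For a state with positive occupation in its unit window, a finite future would force a
  finite past, hence a finite total. Any other state is moved to such a one by an integer time: the
  integer translates of the window tile the time axis, so they cannot all be null when the total is
  infinite.\<close>

lemma AE_future_infinite:
  assumes "AE x in M. emeasure (occ f x) UNIV = \<infinity>"
  shows "AE x in M. emeasure (occ f x) {0..} = \<infinity>"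
proof -
  let ?F = "\<lambda>x. emeasure (occ f x) {0..<1}"
  have U: "emeasure (occ f x) UNIV \<le> emeasure (occ f x) {0..} + emeasure (occ f x) {..<0}" for x
  proof -
    have eq: "UNIV = {0::real..} \<union> {..<0}" by auto
    show ?thesis unfolding eq by (intro emeasure_subadditive) auto
  qed
  have "AE x in M. ?F x > 0 \<longrightarrow> emeasure (occ f x) {0..} = \<infinity>"
    using assms AE_past_finite
  proof eventually_elim
    case (elim x)
    then show ?case using U[of x] by (auto simp: less_top[symmetric] top_unique)
  qed
  then have "AE x in M. ?F (\<phi> (of_int k) x) > 0 \<longrightarrow> emeasure (occ f (\<phi> (of_int k) x)) {0..} = \<infinity>" for k :: int
    by (rule AE_flow)
  then have "AE x in M. \<forall>k::int. ?F (\<phi> (of_int k) x) > 0 \<longrightarrow> emeasure (occ f (\<phi> (of_int k) x)) {0..} = \<infinity>"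
    by (simp add: AE_all_countable)
  then show ?thesis using assms AE_space
  proof eventually_elim
    case (elim x)
    have "\<exists>k::int. ?F (\<phi> (of_int k) x) > 0"
    proof (rule ccontr)
      assume "\<not> ?thesis"
      then have "{real_of_int k..<1 + real_of_int k} \<in> null_sets (occ f x)" for k
        using elim(3) by (auto simp: emeasure_occ_flow_Ico null_sets_def)
      then have "(\<Union>k. {real_of_int k..<1 + real_of_int k}) \<in> null_sets (occ f x)"
        by (intro null_sets_UN) auto
      moreover have "(\<Union>k. {real_of_int k..<1 + real_of_int k}) = UNIV"
      proof -
        have "t \<in> {real_of_int \<lfloor>t\<rfloor>..<1 + real_of_int \<lfloor>t\<rfloor>}" for t by (simp, linarith)
        then show ?thesis by blast
      qed
      ultimately show False using elim(2) by (auto simp: null_sets_def)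
    qed
    then show ?case using elim emeasure_occ_Ici_flow_infinite by blast
  qed
qed

section \<open>Occupation of bounded intervals as real numbers\<close>

lemma emeasure_occ_finite:
  "x \<in> space M \<Longrightarrow> A \<in> sets borel \<Longrightarrow> emeasure lborel A < \<infinity> \<Longrightarrow> emeasure (occ f x) A \<noteq> \<infinity>"
  using emeasure_occ_le[of x A] by (auto simp: top_unique)

lemma emeasure_occ_Ico_finite: "x \<in> space M \<Longrightarrow> emeasure (occ f x) {a..<b} \<noteq> \<infinity>"
  using emeasure_occ_finite[of x "{a..<b}"] by (cases "a \<le> b") simp_all

lemma measure_occ_le:
  assumes "x \<in> space M" "A \<in> sets borel" "emeasure lborel A < \<infinity>"
  shows "measure (occ f x) A \<le> measure lborel A"
  unfolding measure_def using emeasure_occ_le[OF assms(1,2)] assms(3)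
  by (intro enn2real_mono) auto

lemma measure_occ_flow_Ico:
  "x \<in> space M \<Longrightarrow> measure (occ f (\<phi> a x)) {c..<d} = measure (occ f x) {c + a..<d + a}"
  by (simp add: measure_def emeasure_occ_flow_Ico)

lemma measure_occ_split:
  assumes "x \<in> space M" "b \<le> c" "c \<le> d"
  shows "measure (occ f x) {b..<d} = measure (occ f x) {b..<c} + measure (occ f x) {c..<d}"
proof -
  have eq: "{b..<d} = {b..<c} \<union> {c..<d}" using assms by auto
  show ?thesis unfolding eq
    using emeasure_occ_Ico_finite[OF assms(1)] by (intro measure_Union) auto
qed

lemma measure_occ_Ico_diff:
  assumes x: "x \<in> space M" and "b \<le> c" "b' \<le> c'"
  shows "\<bar>measure (occ f x) {b..<c} - measure (occ f x) {b'..<c'}\<bar> \<le> \<bar>b - b'\<bar> + \<bar>c - c'\<bar>"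
proof -
  \<comment> \<open>Measured from a common left end, the occupation of an interval is a difference
    of two values of a 1-Lipschitz function.\<close>
  define a where "a = min b b'"
  have split: "measure (occ f x) {u..<v} = measure (occ f x) {a..<v} - measure (occ f x) {a..<u}"
    if "a \<le> u" "u \<le> v" for u v
    using measure_occ_split[OF x that] by simp
  have lip: "\<bar>measure (occ f x) {a..<u} - measure (occ f x) {a..<v}\<bar> \<le> \<bar>u - v\<bar>"
    if "a \<le> u" "a \<le> v" for u v
  proof -
    have *: "\<bar>measure (occ f x) {a..<u} - measure (occ f x) {a..<v}\<bar> \<le> \<bar>u - v\<bar>"
      if "a \<le> u" "u \<le> v" for u v
      using measure_occ_split[OF x that] measure_occ_le[OF x, of "{u..<v}"] that by simp
    show ?thesis using *[of u v] *[of v u] that by (cases "u \<le> v") (auto simp: abs_minus_commute)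
  qed
  show ?thesis
    using split[of b c] split[of b' c'] lip[of b b'] lip[of c c'] assms(2,3) unfolding a_def by linarith
qed

lemma measure_occ_sum:
  assumes x: "x \<in> space M"
  shows "(\<Sum>k<n. measure (occ f (\<phi> (real k) x)) {0..<1}) = measure (occ f x) {0..<real n}"
proof (induction n)
  case (Suc n)
  then show ?case
    using x measure_occ_split[OF x, of 0 "real n" "1 + real n"] by (simp add: measure_occ_flow_Ico add.commute)
qed simp

lemma measure_occ_measurable[measurable]:
  assumes [measurable]: "A \<in> sets borel"
  shows "(\<lambda>x. measure (occ f x) A) \<in> borel_measurable M"
  unfolding measure_def by measurable

lemma measure_occ_integrable: "integrable M (\<lambda>x. measure (occ f x) {0..<1})"
  and integral_measure_occ: "(\<integral>x. measure (occ f x) {0..<1} \<partial>M) = integral\<^sup>L M f"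
proof -
  have "(\<integral>\<^sup>+x. ennreal (measure (occ f x) {0..<1}) \<partial>M) = (\<integral>\<^sup>+x. emeasure (occ f x) {0..<1} \<partial>M)"
    using emeasure_occ_Ico_finite by (intro nn_integral_cong emeasure_eq_ennreal_measure[symmetric]) auto
  also have "\<dots> = ennreal (integral\<^sup>L M f)"
    using obs_integrable obs_nonneg by (simp add: nn_integral_occ nn_integral_eq_integral)
  finally have eq: "(\<integral>\<^sup>+x. ennreal (measure (occ f x) {0..<1}) \<partial>M) = ennreal (integral\<^sup>L M f)" .
  show "integrable M (\<lambda>x. measure (occ f x) {0..<1})"
    by (rule integrableI_nn_integral_finite[OF _ _ eq]) auto
  show "(\<integral>x. measure (occ f x) {0..<1} \<partial>M) = integral\<^sup>L M f"
    using eq obs_nonneg by (intro integral_eq_nn_integral[THEN trans]) auto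
qed

lemma measure_occ_at_top:
  assumes x: "x \<in> space M" and inf: "emeasure (occ f x) {0..} = \<infinity>"
  shows "filterlim (\<lambda>T. measure (occ f x) {0..<T}) at_top at_top"
  unfolding filterlim_at_top
proof
  fix C :: real
  have "(\<lambda>n. emeasure (occ f x) {0..<real n}) \<longlonglongrightarrow> emeasure (occ f x) (\<Union>n. {0..<real n})"
    by (intro Lim_emeasure_incseq) (auto simp: incseq_def)
  moreover have "(\<Union>n. {0..<real n}) = {0..}"
    using reals_Archimedean2 by fastforce
  ultimately have "(\<lambda>n. emeasure (occ f x) {0..<real n}) \<longlonglongrightarrow> \<infinity>"
    using inf by simp
  then have "eventually (\<lambda>n. emeasure (occ f x) {0..<real n} > ennreal C) sequentially"
    by (rule order_tendstoD) simp
  then obtain n where n: "emeasure (occ f x) {0..<real n} > ennreal C"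
    by (auto simp: eventually_sequentially)
  have "C \<le> measure (occ f x) {0..<T}" if "T \<ge> real n" for T
  proof -
    have "ennreal C < emeasure (occ f x) {0..<real n}" by (rule n)
    also have "\<dots> \<le> emeasure (occ f x) {0..<T}"
      using that by (intro emeasure_mono) auto
    also have "\<dots> = ennreal (measure (occ f x) {0..<T})"
      using emeasure_occ_Ico_finite[OF x] by (intro emeasure_eq_ennreal_measure) auto
    finally show ?thesis by (metis ennreal_less_iff less_eq_real_def linorder_not_less ennreal_leI)
  qed
  then show "eventually (\<lambda>T. C \<le> measure (occ f x) {0..<T}) at_top"
    unfolding eventually_at_top_linorder by auto
qed

end

section \<open>Comparison of two observables\<close>

lemma AE_excess_bounded:
  assumes f: "observable f" and g: "observable g" and "c \<ge> 0"
    and less: "integral\<^sup>L M f < c * integral\<^sup>L M g"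
  shows "AE x in M. \<exists>C::nat. \<forall>n::nat.
    measure (occ f x) {0..<real n} - c * measure (occ g x) {0..<real n} \<le> real C"
proof -
  note [measurable] = measure_occ_measurable[OF f] measure_occ_measurable[OF g]
  define D where "D x n = measure (occ f x) {0..<real n} - c * measure (occ g x) {0..<real n}" for x n
  \<comment> \<open>Sampling at integer times makes \<open>B\<close> measurable by countable
    operations and turns the excess into a Birkhoff sum of the time-one map. Nothing is lost, since
    occupations change by at most 1 between integers.\<close>
  define B where "B = {x\<in>space M. \<forall>C::nat. \<exists>n::nat. D x n > real C}"
  have "B \<in> sets M" unfolding B_def D_def by measurable
  moreover have "\<phi> t x \<in> B" if xB: "x \<in> B" for t x
  proof -
    have x: "x \<in> space M" using xB by (simp add: B_def)
    have "\<exists>n. D (\<phi> t x) n > real C" for C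
    proof -
      \<comment> \<open>Moving along the orbit by \<open>t\<close> changes each occupation by at
        most \<open>2 * \<bar>t\<bar>\<close>, hence the excess by at most \<open>(1 + c)\<close>
        times that. The threshold is raised by this amount in advance.\<close>
      obtain n where n: "D x n > real (C + nat \<lceil>(1 + c) * (2 * \<bar>t\<bar>)\<rceil>)"
        using xB unfolding B_def by blast
      have shift: "\<bar>measure (occ h x) {0..<real n} - measure (occ h (\<phi> t x)) {0..<real n}\<bar> \<le> 2 * \<bar>t\<bar>"
        if "observable h" for h
        using measure_occ_Ico_diff[OF that x, of 0 "real n" t "real n + t"]
        by (simp add: measure_occ_flow_Ico[OF that x])
      have "c * measure (occ g (\<phi> t x)) {0..<real n} \<le> c * measure (occ g x) {0..<real n} + c * (2 * \<bar>t\<bar>)"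
        using shift[OF g] \<open>c \<ge> 0\<close> by (simp flip: distrib_left, intro mult_left_mono, linarith)
      then have "D x n \<le> D (\<phi> t x) n + (1 + c) * (2 * \<bar>t\<bar>)"
        using shift[OF f] unfolding D_def distrib_right by linarith
      moreover have "real (nat \<lceil>(1 + c) * (2 * \<bar>t\<bar>)\<rceil>) \<ge> (1 + c) * (2 * \<bar>t\<bar>)" by linarith
      ultimately show ?thesis using n by (intro exI[of _ n]) simp
    qed
    then show ?thesis using x by (simp add: B_def flow_space)
  qed
  ultimately have "B \<in> null_sets M \<or> space M - B \<in> null_sets M" by (rule ergodic)
  moreover have "space M - B \<notin> null_sets M"
  proof
    assume null: "space M - B \<in> null_sets M"
    let ?F = "\<lambda>x. measure (occ f x) {0..<1} - c * measure (occ g x) {0..<1}"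
    \<comment> \<open>The time-one map of an ergodic flow need not be ergodic, but the maximal
      theorem asks only that it preserve the measure. On \<open>B\<close> the excess exceeds 0 at
      some integer time, which is the positive Birkhoff sum required.\<close>
    have "integral\<^sup>L M ?F \<ge> 0"
    proof (rule maximal_ergodic[OF flow_measurable distr_flow])
      show "integrable M ?F"
        using measure_occ_integrable[OF f] measure_occ_integrable[OF g] by auto
      have "AE x in M. x \<in> B" using AE_not_in[OF null] AE_space by eventually_elim auto
      then show "AE x in M. \<exists>n. (\<Sum>k<n. ?F ((\<phi> 1 ^^ k) x)) > 0"
      proof eventually_elim
        case (elim x)
        then have x: "x \<in> space M" by (simp add: B_def)
        obtain n where "D x n > real 0" using elim unfolding B_def by blast
        moreover have "(\<Sum>k<n. ?F ((\<phi> 1 ^^ k) x)) = D x n"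
          using x by (simp add: flow_funpow sum_subtractf D_def measure_occ_sum[OF f] measure_occ_sum[OF g]
            flip: sum_distrib_left)
        ultimately show ?case by (intro exI[of _ n]) simp
      qed
    qed
    moreover have "integral\<^sup>L M ?F = integral\<^sup>L M f - c * integral\<^sup>L M g"
      using measure_occ_integrable[OF f] measure_occ_integrable[OF g]
      by (simp add: integral_measure_occ[OF f] integral_measure_occ[OF g])
    ultimately show False using less by simp
  qed
  ultimately have "B \<in> null_sets M" by simp
  from AE_not_in[OF this] AE_space show ?thesis
    by eventually_elim (auto simp: B_def D_def not_less)
qed

text \<open>The excess bound is used in both directions with a factor slightly above 1. The bounded
  error is absorbed into a slightly larger factor because both occupations diverge.\<close>

lemma ratio_limit:
  assumes f: "observable f" and g: "observable g"
    and eq: "integral\<^sup>L M f = integral\<^sup>L M g" and pos: "integral\<^sup>L M f > 0"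
    and inf: "AE x in M. emeasure (occ g x) {0..} = \<infinity>"
      "AE x in M. emeasure (occ f x) {0..} = \<infinity>"
  shows "AE x in M. ((\<lambda>T. measure (occ f x) {0..<T} / measure (occ g x) {0..<T}) \<longlongrightarrow> 1) at_top"
proof -
  have bound: "AE x in M. \<forall>k::nat. eventually (\<lambda>T. measure (occ f x) {0..<T} \<le>
      (1 + 2 / (real k + 1)) * measure (occ g x) {0..<T}) at_top"
    if f: "observable f" and g: "observable g" and eq: "integral\<^sup>L M f = integral\<^sup>L M g"
      and pos: "integral\<^sup>L M f > 0" and inf: "AE x in M. emeasure (occ g x) {0..} = \<infinity>" for f g
    unfolding AE_all_countable
  proof
    fix k :: nat
    define c where "c = 1 + 1 / (real k + 1)"
    have "c \<ge> 0" by (simp add: c_def)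
    moreover have "integral\<^sup>L M f < c * integral\<^sup>L M g"
      using pos by (simp add: c_def eq distrib_right)
    ultimately have "AE x in M. \<exists>C::nat. \<forall>n::nat.
        measure (occ f x) {0..<real n} - c * measure (occ g x) {0..<real n} \<le> real C"
      by (rule AE_excess_bounded[OF f g])
    then
    show "AE x in M. eventually (\<lambda>T. measure (occ f x) {0..<T} \<le>
        (1 + 2 / (real k + 1)) * measure (occ g x) {0..<T}) at_top"
      using inf AE_space
    proof eventually_elim
      case (elim x)
      note x = elim(3)
      obtain C :: nat where C: "measure (occ f x) {0..<real n} - c * measure (occ g x) {0..<real n} \<le> real C" for n :: nat
        using elim(1) by (auto simp: c_def)
      \<comment> \<open>The error is \<open>C\<close> at the integer part of \<open>T\<close> and at
        most 1 for the fractional part. Beyond this threshold it is at most the fraction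
        \<open>1 / (real k + 1)\<close> of the occupation, which raises the factor from
        \<open>c\<close> to \<open>1 + 2 / (real k + 1)\<close>.\<close>
      have "eventually (\<lambda>T. measure (occ g x) {0..<T} \<ge> (real C + 1) * (real k + 1)) at_top"
        using measure_occ_at_top[OF g x elim(2)] by (simp add: filterlim_at_top)
      then show ?case using eventually_ge_at_top[of 0]
      proof eventually_elim
        case (elim T)
        define n where "n = nat \<lfloor>T\<rfloor>"
        have n: "real n \<le> T" "T \<le> real n + 1" using elim by (auto simp: n_def)
        have "measure (occ f x) {0..<T} \<le> measure (occ f x) {0..<real n} + 1"
          using measure_occ_Ico_diff[OF f x, of 0 T 0 "real n"] n by simp
        also have "\<dots> \<le> c * measure (occ g x) {0..<real n} + (real C + 1)" using C[of n] by simp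
        also have "c * measure (occ g x) {0..<real n} \<le> c * measure (occ g x) {0..<T}"
          using measure_occ_split[OF g x, of 0 "real n" T] n by (intro mult_left_mono) (auto simp: c_def)
        also have "real C + 1 \<le> 1 / (real k + 1) * measure (occ g x) {0..<T}"
          using elim by (simp add: field_simps)
        finally show ?case by (simp add: c_def algebra_simps add_divide_distrib)
      qed
    qed
  qed
  show ?thesis
    using bound[OF f g eq pos inf(1)] bound[OF g f eq[symmetric] pos[unfolded eq] inf(2)] inf AE_space
  proof eventually_elim
    case (elim x)
    note x = elim(5)
    show ?case
    proof (rule tendstoI)
      fix e :: real assume "e > 0"
      obtain k :: nat where "inverse (real (Suc k)) < e / 2"
        using reals_Archimedean[of "e / 2"] \<open>e > 0\<close> by auto
      then have k: "2 / (real k + 1) < e" by (simp add: field_simps)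
      let ?d = "2 / (real k + 1)"
      have "eventually (\<lambda>T. measure (occ f x) {0..<T} > 0) at_top"
        "eventually (\<lambda>T. measure (occ g x) {0..<T} > 0) at_top"
        using measure_occ_at_top[OF f x elim(4)] measure_occ_at_top[OF g x elim(3)]
        by (auto simp: filterlim_at_top_dense)
      then show "eventually (\<lambda>T. dist (measure (occ f x) {0..<T} / measure (occ g x) {0..<T}) 1 < e) at_top"
        using elim(1)[rule_format, of k] elim(2)[rule_format, of k]
      proof eventually_elim
        case (elim T)
        define a b where "a = measure (occ f x) {0..<T}" and "b = measure (occ g x) {0..<T}"
        have ab: "a > 0" "b > 0" "a \<le> (1 + ?d) * b" "b \<le> (1 + ?d) * a"
          using elim by (auto simp: a_def b_def)
        \<comment> \<open>The lower bound on \<open>a\<close> comes from dividing by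
          \<open>1 + ?d\<close> and \<open>(1 - ?d) * (1 + ?d) \<le> 1\<close>. For
          \<open>?d > 1\<close> the factor \<open>1 - ?d\<close> is negative and the bound is
          trivial.\<close>
        have "(1 - ?d) * b \<le> (1 - ?d) * (1 + ?d) * a" if "?d \<le> 1"
          using mult_left_mono[OF ab(4), of "1 - ?d"] that by (simp add: mult.assoc)
        moreover have "(1 - ?d) * (1 + ?d) * a \<le> 1 * a"
          using ab by (intro mult_right_mono) (auto simp: algebra_simps)
        moreover have "(1 - ?d) * b \<le> 0" if "?d > 1" using that ab by (intro mult_nonpos_nonneg) auto
        ultimately have "(1 - ?d) * b \<le> a" using ab by linarith
        then have "\<bar>a - b\<bar> \<le> ?d * b" using ab by (simp add: algebra_simps abs_le_iff)
        also have "\<dots> < e * b" using k ab(2) by (rule mult_strict_right_mono)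
        finally have "\<bar>a - b\<bar> / b < e" using ab by (simp add: field_simps)
        moreover have "a / b - 1 = (a - b) / b" using ab by (simp add: diff_divide_distrib)
        then have "dist (a / b) 1 = \<bar>a - b\<bar> / b" using ab by (simp add: dist_real_def abs_divide)
        ultimately show ?case by (simp add: a_def b_def)
      qed
    qed
  qed
qed

end

section \<open>Orbits of the billiard\<close>

lemma l1_dist_le_cmod: "l1_dist x y \<le> 2 * cmod (x - y)"
  using abs_Re_le_cmod[of "x - y"] abs_Im_le_cmod[of "x - y"] by (simp add: l1_dist_def)

lemma cmod_le_l1_dist: "cmod (x - y) \<le> l1_dist x y"
  using cmod_le[of "x - y"] by (simp add: l1_dist_def)

lemma closed_tree: "closed (tree s z)"
proof -
  have "tree s z = (\<lambda>w. l1_dist w z) -` {..s / 2}" by (auto simp: tree_def)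
  then show ?thesis
    unfolding l1_dist_def by (auto intro!: closed_vimage continuous_intros)
qed

lemma convex_tree: "convex (tree s z)"
proof (rule convexI)
  fix x y :: complex and u v :: real
  assume xy: "x \<in> tree s z" "y \<in> tree s z" and uv: "0 \<le> u" "0 \<le> v" "u + v = 1"
  have Re: "Re (u *\<^sub>R x + v *\<^sub>R y) - Re z = u * (Re x - Re z) + v * (Re y - Re z)"
    and Im: "Im (u *\<^sub>R x + v *\<^sub>R y) - Im z = u * (Im x - Im z) + v * (Im y - Im z)"
    using uv(3) by (simp_all add: algebra_simps flip: distrib_right)
  have "l1_dist (u *\<^sub>R x + v *\<^sub>R y) z \<le> u * l1_dist x z + v * l1_dist y z"
    unfolding l1_dist_def Re Im
    using abs_triangle_ineq[of "u * (Re x - Re z)" "v * (Re y - Re z)"]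
      abs_triangle_ineq[of "u * (Im x - Im z)" "v * (Im y - Im z)"] uv
    by (simp add: abs_mult distrib_left)
  also have "\<dots> \<le> u * (s / 2) + v * (s / 2)"
    using xy uv by (intro add_mono mult_left_mono) (auto simp: tree_def)
  also have "\<dots> = s / 2" using uv(3) by (simp flip: distrib_right)
  finally show "u *\<^sub>R x + v *\<^sub>R y \<in> tree s z" by (simp add: tree_def)
qed

lemma center_in_interior_tree:
  assumes "s > 0"
  shows "z \<in> interior (tree s z)"
proof -
  have "ball z (s / 4) \<subseteq> tree s z"
  proof
    fix w assume "w \<in> ball z (s / 4)"
    then show "w \<in> tree s z" using l1_dist_le_cmod[of w z]
      by (auto simp: tree_def dist_norm norm_minus_commute)
  qed
  then show ?thesis using assms by (meson centre_in_ball interiorI open_ball zero_less_divide_iff zero_less_numeral)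
qed

lemma corners_subset_tree: "s > 0 \<Longrightarrow> corners s z \<subseteq> tree s z"
  by (auto simp: corners_def tree_def l1_dist_def)

lemma norm_velocity: "cmod u = 1 \<Longrightarrow> cmod (velocity u) = 1"
  by (simp add: velocity_def norm_mult)

lemma finite_directions: "finite (directions \<theta>)"
  by (simp add: directions_def)

lemma reflect_eq_iff: "reflect z p u = reflect z p v \<longleftrightarrow> u = v"
  by (simp add: reflect_def)

lemma closed_table: "closed (table s g)"
  unfolding table_def by (intro closed_Diff open_UN) auto

locale wind_tree =
  fixes s :: real and g :: "complex set" and \<theta> :: complex
  assumes s_pos: "s > 0" and conf: "g \<in> Conf s" and circ: "\<theta> \<in> circle"
begin

lemma norm_directions: "u \<in> directions \<theta> \<Longrightarrow> cmod u = 1"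
  using circ by (auto simp: directions_def circle_def)

lemma closure_interior_tree: "closure (interior (tree s z)) = tree s z"
  using center_in_interior_tree[OF s_pos, of z] closed_tree convex_closure_interior[OF convex_tree, of s z]
  by auto

text \<open>An open set that misses the interior of a tree misses its closure as well, and for a
  convex set with nonempty interior this closure is the whole tree.\<close>

lemma tree_disjoint_interior_table:
  assumes "z \<in> g"
  shows "tree s z \<inter> interior (table s g) = {}"
proof -
  have "interior (table s g) \<inter> interior (tree s z) = {}"
    using interior_subset[of "table s g"] assms by (auto simp: table_def)
  then have "interior (table s g) \<inter> closure (interior (tree s z)) = {}"
    by (simp add: open_Int_closure_eq_empty)
  then show ?thesis by (auto simp: closure_interior_tree)
qed

lemma uniform_discrete_conf: "uniform_discrete g"
  unfolding uniform_discrete_def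
proof (intro exI[of _ "s / 2"] conjI ballI impI)
  fix x y assume "x \<in> g" "y \<in> g" "dist x y < s / 2"
  moreover from this have "\<not> s \<le> l1_dist x y"
    using l1_dist_le_cmod[of x y] by (simp add: dist_norm)
  ultimately show "x = y" using conf unfolding Conf_def by blast
qed (use s_pos in auto)

text \<open>Centres are uniformly separated, so only finitely many trees meet a given unit
  disc.\<close>

lemma closed_Union_trees: "closed (\<Union>z\<in>g. tree s z)"
proof -
  have "locally_finite_in euclidean (tree s ` g)"
    unfolding locally_finite_in_def
  proof (intro conjI ballI)
    fix p :: complex
    have "{U \<in> tree s ` g. U \<inter> ball p 1 \<noteq> {}} \<subseteq> tree s ` (g \<inter> cball p (1 + s))"
    proof
      fix U assume "U \<in> {U \<in> tree s ` g. U \<inter> ball p 1 \<noteq> {}}"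
      then obtain z w where "z \<in> g" and U: "U = tree s z" and w: "w \<in> tree s z" "w \<in> ball p 1"
        by blast
      have "dist p z \<le> dist p w + dist w z" by (rule dist_triangle)
      then have "dist p z \<le> 1 + s"
        using w cmod_le_l1_dist[of w z] s_pos by (auto simp: tree_def dist_norm)
      then show "U \<in> tree s ` (g \<inter> cball p (1 + s))" using \<open>z \<in> g\<close> U by auto
    qed
    moreover have "finite (g \<inter> cball p (1 + s))"
      using uniform_discrete_subset[OF uniform_discrete_conf, of "g \<inter> cball p (1 + s)"]
      by (simp add: bounded_Int flip: uniform_discrete_finite_iff)
    ultimately have "finite {U \<in> tree s ` g. U \<inter> ball p 1 \<noteq> {}}"
      by (meson finite_imageI finite_subset)
    then show "\<exists>V. openin euclidean V \<and> p \<in> V \<and> finite {U \<in> tree s ` g. U \<inter> V \<noteq> {}}"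
      by (intro exI[of _ "ball p 1"]) auto
  qed auto
  then show ?thesis
    using closedin_locally_finite_Union[of "tree s ` g" euclidean] closed_tree by auto
qed

text \<open>Since the union of the trees is closed, its complement is an open part of the table. A
  table point outside the interior therefore lies in some tree, but not in the interior of that
  tree; accumulating trees cannot create further boundary points.\<close>

lemma boundary_table:
  assumes "p \<in> table s g" "p \<notin> interior (table s g)"
  obtains z where "z \<in> g" "p \<in> frontier (tree s z)"
proof -
  have "- (\<Union>z\<in>g. tree s z) \<subseteq> interior (table s g)"
  proof (rule interior_maximal)
    show "- (\<Union>z\<in>g. tree s z) \<subseteq> table s g" using interior_subset by (auto simp: table_def)
  qed (use closed_Union_trees in \<open>simp add: open_Compl del: Compl_UN\<close>)
  then obtain z where "z \<in> g" "p \<in> tree s z" using assms(2) by auto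
  then have "p \<in> frontier (tree s z)"
    using assms(1) closed_tree[of s z] by (auto simp: frontier_def table_def)
  then show ?thesis using that \<open>z \<in> g\<close> by blast
qed

text \<open>The direction just before the present time. A boundary point may lie on two touching
  trees; the orbit condition holds for each of them, so a fixed choice is legitimate. Because the
  choice depends on the point alone, two orbits through one state get the same incoming
  direction.\<close>

definition incoming :: "complex \<Rightarrow> complex \<Rightarrow> complex" where
  "incoming p u = (if p \<in> interior (table s g) then u
     else reflect (SOME z. z \<in> g \<and> p \<in> frontier (tree s z)) p u)"

lemma incoming_eq_iff: "incoming p u = incoming p v \<longleftrightarrow> u = v"
  by (simp add: incoming_def reflect_eq_iff)

lemma incoming_directions: "u \<in> directions \<theta> \<Longrightarrow> incoming p u \<in> directions \<theta>"
  by (auto simp: incoming_def reflect_def directions_def)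

section \<open>Local form and uniqueness of orbits\<close>

abbreviation orbit :: "real set \<Rightarrow> (real \<Rightarrow> state) \<Rightarrow> bool" where
  "orbit \<equiv> billiard_orbit s g \<theta>"

text \<open>The orbit condition at a single time, with position and direction as projections, so
  that it can be transported under shifts, restrictions and gluing.\<close>

definition orbit_at :: "real set \<Rightarrow> (real \<Rightarrow> state) \<Rightarrow> real \<Rightarrow> bool" where
  "orbit_at I \<gamma> t \<longleftrightarrow>
     fst (\<gamma> t) \<in> table s g \<and> snd (\<gamma> t) \<in> directions \<theta> \<and> (\<forall>z\<in>g. fst (\<gamma> t) \<notin> corners s z) \<and>
     (fst (\<gamma> t) \<in> interior (table s g) \<longrightarrow>
        (\<exists>\<epsilon>>0. \<forall>\<tau>\<in>I. \<bar>\<tau> - t\<bar> < \<epsilon> \<longrightarrow>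
           \<gamma> \<tau> = (fst (\<gamma> t) + of_real (\<tau> - t) * velocity (snd (\<gamma> t)), snd (\<gamma> t)))) \<and>
     (\<forall>z\<in>g. fst (\<gamma> t) \<in> frontier (tree s z) \<longrightarrow>
        (\<exists>\<epsilon>>0. \<forall>\<tau>\<in>I.
           (t \<le> \<tau> \<and> \<tau> < t + \<epsilon> \<longrightarrow>
              \<gamma> \<tau> = (fst (\<gamma> t) + of_real (\<tau> - t) * velocity (snd (\<gamma> t)), snd (\<gamma> t))) \<and>
           (t - \<epsilon> < \<tau> \<and> \<tau> < t \<longrightarrow>
              \<gamma> \<tau> = (fst (\<gamma> t) + of_real (\<tau> - t) * velocity (reflect z (fst (\<gamma> t)) (snd (\<gamma> t))),
                reflect z (fst (\<gamma> t)) (snd (\<gamma> t))))))"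

lemma orbit_iff: "orbit I \<gamma> \<longleftrightarrow> (\<forall>t\<in>I. orbit_at I \<gamma> t)"
proof -
  have ex: "(\<exists>p u. \<gamma> t = (p, u) \<and> Q p u) \<longleftrightarrow> Q (fst (\<gamma> t)) (snd (\<gamma> t))" for Q t
    by (cases "\<gamma> t") simp
  show ?thesis
    unfolding billiard_orbit_def orbit_at_def Let_def ex ..
qed

text \<open>With \<open>\<gamma>' True = \<gamma>' False\<close> this transports the condition along a time shift or a restriction.\<close>

lemma orbit_at_glue:
  fixes J :: "bool \<Rightarrow> real set"
  assumes at: "\<And>b. orbit_at (J b) (\<gamma>' b) (t + a)" and eq: "\<And>b. \<gamma>' b (t + a) = \<gamma> t"
    and \<delta>: "\<delta> > 0" "\<And>\<tau>. \<tau> \<in> I \<Longrightarrow> \<bar>\<tau> - t\<bar> < \<delta> \<Longrightarrow> \<exists>b. \<tau> + a \<in> J b \<and> \<gamma> \<tau> = \<gamma>' b (\<tau> + a)"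
  shows "orbit_at I \<gamma> t"
proof -
  have shift: "\<tau> + a - (t + a) = \<tau> - t" for \<tau> by simp
  have state: "fst (\<gamma> t) \<in> table s g" "snd (\<gamma> t) \<in> directions \<theta>" "\<forall>z\<in>g. fst (\<gamma> t) \<notin> corners s z"
    using at[of True] unfolding orbit_at_def eq by auto
  have int: "\<exists>\<epsilon>>0. \<forall>\<tau>\<in>I. \<bar>\<tau> - t\<bar> < \<epsilon> \<longrightarrow>
      \<gamma> \<tau> = (fst (\<gamma> t) + of_real (\<tau> - t) * velocity (snd (\<gamma> t)), snd (\<gamma> t))"
    if "fst (\<gamma> t) \<in> interior (table s g)"
  proof -
    have "\<forall>b. \<exists>\<epsilon>>0. \<forall>\<tau>\<in>J b. \<bar>\<tau> - (t + a)\<bar> < \<epsilon> \<longrightarrow>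
        \<gamma>' b \<tau> = (fst (\<gamma> t) + of_real (\<tau> - (t + a)) * velocity (snd (\<gamma> t)), snd (\<gamma> t))"
      using at that unfolding orbit_at_def eq by blast
    then obtain e where e: "\<And>b. e b > 0" "\<And>b \<tau>. \<tau> \<in> J b \<Longrightarrow> \<bar>\<tau> - (t + a)\<bar> < e b \<Longrightarrow>
        \<gamma>' b \<tau> = (fst (\<gamma> t) + of_real (\<tau> - (t + a)) * velocity (snd (\<gamma> t)), snd (\<gamma> t))"
      by metis
    define \<epsilon> where "\<epsilon> = Min {\<delta>, e True, e False}"
    have \<epsilon>: "\<epsilon> > 0" "\<epsilon> \<le> \<delta>" "\<epsilon> \<le> e b" for b using e(1) \<delta>(1) by (cases b; auto simp: \<epsilon>_def)+
    have "\<gamma> \<tau> = (fst (\<gamma> t) + of_real (\<tau> - t) * velocity (snd (\<gamma> t)), snd (\<gamma> t))"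
      if \<tau>: "\<tau> \<in> I" "\<bar>\<tau> - t\<bar> < \<epsilon>" for \<tau>
    proof -
      obtain b where b: "\<tau> + a \<in> J b" "\<gamma> \<tau> = \<gamma>' b (\<tau> + a)" using \<delta>(2)[of \<tau>] \<tau> \<epsilon>(2) by auto
      then show ?thesis using e(2)[OF b(1)] \<tau>(2) \<epsilon>(3)[of b] unfolding shift by simp
    qed
    then show ?thesis using \<epsilon>(1) by blast
  qed
  have fr: "\<exists>\<epsilon>>0. \<forall>\<tau>\<in>I. (t \<le> \<tau> \<and> \<tau> < t + \<epsilon> \<longrightarrow>
        \<gamma> \<tau> = (fst (\<gamma> t) + of_real (\<tau> - t) * velocity (snd (\<gamma> t)), snd (\<gamma> t))) \<and>
      (t - \<epsilon> < \<tau> \<and> \<tau> < t \<longrightarrow> \<gamma> \<tau> = (fst (\<gamma> t) + of_real (\<tau> - t) * velocity v, v))"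
    if "z \<in> g" "fst (\<gamma> t) \<in> frontier (tree s z)" and v: "v = reflect z (fst (\<gamma> t)) (snd (\<gamma> t))" for z v
  proof -
    have "\<forall>b. \<exists>\<epsilon>>0. \<forall>\<tau>\<in>J b. (t + a \<le> \<tau> \<and> \<tau> < t + a + \<epsilon> \<longrightarrow>
          \<gamma>' b \<tau> = (fst (\<gamma> t) + of_real (\<tau> - (t + a)) * velocity (snd (\<gamma> t)), snd (\<gamma> t))) \<and>
        (t + a - \<epsilon> < \<tau> \<and> \<tau> < t + a \<longrightarrow> \<gamma>' b \<tau> = (fst (\<gamma> t) + of_real (\<tau> - (t + a)) * velocity v, v))"
      using at that unfolding orbit_at_def eq v by blast
    then obtain e where e: "\<And>b. e b > 0" "\<And>b \<tau>. \<tau> \<in> J b \<Longrightarrow> (t + a \<le> \<tau> \<and> \<tau> < t + a + e b \<longrightarrow>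
          \<gamma>' b \<tau> = (fst (\<gamma> t) + of_real (\<tau> - (t + a)) * velocity (snd (\<gamma> t)), snd (\<gamma> t))) \<and>
        (t + a - e b < \<tau> \<and> \<tau> < t + a \<longrightarrow> \<gamma>' b \<tau> = (fst (\<gamma> t) + of_real (\<tau> - (t + a)) * velocity v, v))"
      by metis
    define \<epsilon> where "\<epsilon> = Min {\<delta>, e True, e False}"
    have \<epsilon>: "\<epsilon> > 0" "\<epsilon> \<le> \<delta>" "\<epsilon> \<le> e b" for b using e(1) \<delta>(1) by (cases b; auto simp: \<epsilon>_def)+
    have "(t \<le> \<tau> \<and> \<tau> < t + \<epsilon> \<longrightarrow>
        \<gamma> \<tau> = (fst (\<gamma> t) + of_real (\<tau> - t) * velocity (snd (\<gamma> t)), snd (\<gamma> t))) \<and>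
      (t - \<epsilon> < \<tau> \<and> \<tau> < t \<longrightarrow> \<gamma> \<tau> = (fst (\<gamma> t) + of_real (\<tau> - t) * velocity v, v))"
      if \<tau>: "\<tau> \<in> I" for \<tau>
    proof (cases "\<bar>\<tau> - t\<bar> < \<epsilon>")
      case True
      obtain b where b: "\<tau> + a \<in> J b" "\<gamma> \<tau> = \<gamma>' b (\<tau> + a)" using \<delta>(2)[of \<tau>] \<tau> True \<epsilon>(2) by auto
      then show ?thesis using e(2)[OF b(1)] \<epsilon>(3)[of b] unfolding shift by auto
    qed auto
    then show ?thesis using \<epsilon>(1) by blast
  qed
  show ?thesis
    unfolding orbit_at_def using state int fr by blast
qed

lemma orbit_shift:
  assumes "orbit I \<gamma>" "\<And>t. t \<in> J \<Longrightarrow> t + a \<in> I"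
  shows "orbit J (\<lambda>t. \<gamma> (t + a))"
  unfolding orbit_iff
proof
  fix t assume "t \<in> J"
  show "orbit_at J (\<lambda>t. \<gamma> (t + a)) t"
  proof (rule orbit_at_glue[where J = "\<lambda>_. I" and \<gamma>' = "\<lambda>_. \<gamma>" and a = a and \<delta> = 1])
    show "orbit_at I \<gamma> (t + a)" using assms(1) assms(2)[OF \<open>t \<in> J\<close>] unfolding orbit_iff by blast
  qed (use assms(2) in simp_all)
qed

lemma orbit_subset: "orbit J \<gamma> \<Longrightarrow> I \<subseteq> J \<Longrightarrow> orbit I \<gamma>"
  using orbit_shift[of J \<gamma> I 0] by (simp add: subset_eq)

lemma orbit_state:
  assumes "orbit I \<gamma>" "t \<in> I"
  shows "fst (\<gamma> t) \<in> table s g" "snd (\<gamma> t) \<in> directions \<theta>"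
  using assms unfolding orbit_iff orbit_at_def by blast+

lemma orbit_local:
  assumes "orbit I \<gamma>" "t \<in> I"
  obtains \<epsilon> where "\<epsilon> > 0"
    "\<And>\<tau>. \<tau> \<in> I \<Longrightarrow> t \<le> \<tau> \<Longrightarrow> \<tau> < t + \<epsilon> \<Longrightarrow>
      \<gamma> \<tau> = (fst (\<gamma> t) + of_real (\<tau> - t) * velocity (snd (\<gamma> t)), snd (\<gamma> t))"
    "\<And>\<tau>. \<tau> \<in> I \<Longrightarrow> t - \<epsilon> < \<tau> \<Longrightarrow> \<tau> < t \<Longrightarrow>
      \<gamma> \<tau> = (fst (\<gamma> t) + of_real (\<tau> - t) * velocity (incoming (fst (\<gamma> t)) (snd (\<gamma> t))),
        incoming (fst (\<gamma> t)) (snd (\<gamma> t)))"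
proof -
  define p u where "p = fst (\<gamma> t)" and "u = snd (\<gamma> t)"
  note that' = that[folded p_def u_def]
  have at: "orbit_at I \<gamma> t" using assms by (simp add: orbit_iff)
  show ?thesis
  proof (cases "p \<in> interior (table s g)")
    case True
    then obtain \<epsilon> where \<epsilon>: "\<epsilon> > 0" "\<forall>\<tau>\<in>I. \<bar>\<tau> - t\<bar> < \<epsilon> \<longrightarrow> \<gamma> \<tau> = (p + of_real (\<tau> - t) * velocity u, u)"
      using at unfolding orbit_at_def p_def u_def by blast
    have u: "incoming p u = u" using True by (simp add: incoming_def)
    have eq: "\<gamma> \<tau> = (p + of_real (\<tau> - t) * velocity u, u)" if "\<tau> \<in> I" "\<bar>\<tau> - t\<bar> < \<epsilon>" for \<tau>
      by (rule \<epsilon>(2)[rule_format, OF that])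
    have r: "\<gamma> \<tau> = (p + of_real (\<tau> - t) * velocity u, u)" if "\<tau> \<in> I" "t \<le> \<tau>" "\<tau> < t + \<epsilon>" for \<tau>
      by (rule eq[OF that(1)]) (use that in linarith)
    have l: "\<gamma> \<tau> = (p + of_real (\<tau> - t) * velocity (incoming p u), incoming p u)"
      if "\<tau> \<in> I" "t - \<epsilon> < \<tau>" "\<tau> < t" for \<tau>
      unfolding u by (rule eq[OF that(1)]) (use that in linarith)
    show ?thesis 
    proof (rule that'[OF \<epsilon>(1)], goal_cases)
      case (1 \<tau>) then show ?case by (rule r)
    next
      case (2 \<tau>) then show ?case by (rule l)
    qed
  next
    case False
    define z where "z = (SOME z. z \<in> g \<and> p \<in> frontier (tree s z))"
    have "p \<in> table s g" using at unfolding orbit_at_def p_def by blast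
    then have "\<exists>z. z \<in> g \<and> p \<in> frontier (tree s z)"
      by (rule boundary_table[OF _ False]) blast
    then have "z \<in> g \<and> p \<in> frontier (tree s z)"
      unfolding z_def by (rule someI_ex)
    then obtain \<epsilon> where \<epsilon>: "\<epsilon> > 0" "\<forall>\<tau>\<in>I.
          (t \<le> \<tau> \<and> \<tau> < t + \<epsilon> \<longrightarrow> \<gamma> \<tau> = (p + of_real (\<tau> - t) * velocity u, u)) \<and>
          (t - \<epsilon> < \<tau> \<and> \<tau> < t \<longrightarrow> \<gamma> \<tau> = (p + of_real (\<tau> - t) * velocity (reflect z p u), reflect z p u))"
      using at unfolding orbit_at_def p_def u_def by blast
    have u: "incoming p u = reflect z p u" using False by (simp add: incoming_def z_def)
    have r: "\<gamma> \<tau> = (p + of_real (\<tau> - t) * velocity u, u)" if "\<tau> \<in> I" "t \<le> \<tau>" "\<tau> < t + \<epsilon>" for \<tau>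
      by (rule \<epsilon>(2)[rule_format, OF that(1), THEN conjunct1, rule_format]) (use that in simp)
    have l: "\<gamma> \<tau> = (p + of_real (\<tau> - t) * velocity (incoming p u), incoming p u)"
      if "\<tau> \<in> I" "t - \<epsilon> < \<tau>" "\<tau> < t" for \<tau>
      unfolding u by (rule \<epsilon>(2)[rule_format, OF that(1), THEN conjunct2, rule_format]) (use that in simp)
    show ?thesis 
    proof (rule that'[OF \<epsilon>(1)], goal_cases)
      case (1 \<tau>) then show ?case by (rule r)
    next
      case (2 \<tau>) then show ?case by (rule l)
    qed
  qed
qed

text \<open>Both one-sided motions have unit speed, collision or not. Its use is to keep apart, for
  a short time, two orbits at different positions.\<close>

lemma orbit_step_dist:
  assumes "orbit I \<gamma>" "t \<in> I"
  obtains \<epsilon> where "\<epsilon> > 0" "\<And>\<tau>. \<tau> \<in> I \<Longrightarrow> \<bar>\<tau> - t\<bar> < \<epsilon> \<Longrightarrow> cmod (fst (\<gamma> \<tau>) - fst (\<gamma> t)) = \<bar>\<tau> - t\<bar>"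
proof -
  note nd = norm_velocity[OF norm_directions]
  from orbit_local[OF assms] obtain \<epsilon> where *: "\<epsilon> > 0"
    "\<And>\<tau>. \<tau> \<in> I \<Longrightarrow> t \<le> \<tau> \<Longrightarrow> \<tau> < t + \<epsilon> \<Longrightarrow>
      \<gamma> \<tau> = (fst (\<gamma> t) + of_real (\<tau> - t) * velocity (snd (\<gamma> t)), snd (\<gamma> t))"
    "\<And>\<tau>. \<tau> \<in> I \<Longrightarrow> t - \<epsilon> < \<tau> \<Longrightarrow> \<tau> < t \<Longrightarrow>
      \<gamma> \<tau> = (fst (\<gamma> t) + of_real (\<tau> - t) * velocity (incoming (fst (\<gamma> t)) (snd (\<gamma> t))),
        incoming (fst (\<gamma> t)) (snd (\<gamma> t)))" by blast
  show ?thesis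
  proof (rule that[OF *(1)])
    fix \<tau> assume "\<tau> \<in> I" "\<bar>\<tau> - t\<bar> < \<epsilon>"
    then consider "t \<le> \<tau>" "\<tau> < t + \<epsilon>" | "t - \<epsilon> < \<tau>" "\<tau> < t" by linarith
    then obtain v where v: "v \<in> directions \<theta>" "fst (\<gamma> \<tau>) = fst (\<gamma> t) + of_real (\<tau> - t) * velocity v"
    proof cases
      case 1
      show ?thesis
        using that[OF orbit_state(2)[OF assms]] *(2)[OF \<open>\<tau> \<in> I\<close> 1] by (metis fst_conv)
    next
      case 2
      show ?thesis
        using that[OF incoming_directions[OF orbit_state(2)[OF assms]]] *(3)[OF \<open>\<tau> \<in> I\<close> 2] by (metis fst_conv)
    qed
    then show "cmod (fst (\<gamma> \<tau>) - fst (\<gamma> t)) = \<bar>\<tau> - t\<bar>"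
      using nd[OF v(1)] by (simp add: norm_mult del: of_real_diff)
  qed
qed

text \<open>Agreement of two orbits is locally constant in time, hence constant on a connected
  interval. At equal positions the later direction is the present one and the earlier direction is
  its incoming one; both determine the present direction. At different positions unit speed keeps
  the orbits apart for a while.\<close>

lemma orbit_unique:
  assumes I: "connected I" "t0 \<in> I" "t \<in> I"
    and o1: "orbit I \<gamma>1" and o2: "orbit I \<gamma>2" and eq: "\<gamma>1 t0 = \<gamma>2 t0"
  shows "\<gamma>1 t = \<gamma>2 t"
proof -
  have "(\<gamma>1 t0 = \<gamma>2 t0) = (\<gamma>1 t = \<gamma>2 t)"
  proof (rule connected_local_const[OF I], intro ballI)
    fix a assume a: "a \<in> I"
    from orbit_local[OF o1 a] obtain e1 where e1: "e1 > 0"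
      "\<And>\<tau>. \<tau> \<in> I \<Longrightarrow> a \<le> \<tau> \<Longrightarrow> \<tau> < a + e1 \<Longrightarrow>
        \<gamma>1 \<tau> = (fst (\<gamma>1 a) + of_real (\<tau> - a) * velocity (snd (\<gamma>1 a)), snd (\<gamma>1 a))"
      "\<And>\<tau>. \<tau> \<in> I \<Longrightarrow> a - e1 < \<tau> \<Longrightarrow> \<tau> < a \<Longrightarrow>
        \<gamma>1 \<tau> = (fst (\<gamma>1 a) + of_real (\<tau> - a) * velocity (incoming (fst (\<gamma>1 a)) (snd (\<gamma>1 a))),
          incoming (fst (\<gamma>1 a)) (snd (\<gamma>1 a)))" by blast
    from orbit_local[OF o2 a] obtain e2 where e2: "e2 > 0"
      "\<And>\<tau>. \<tau> \<in> I \<Longrightarrow> a \<le> \<tau> \<Longrightarrow> \<tau> < a + e2 \<Longrightarrow>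
        \<gamma>2 \<tau> = (fst (\<gamma>2 a) + of_real (\<tau> - a) * velocity (snd (\<gamma>2 a)), snd (\<gamma>2 a))"
      "\<And>\<tau>. \<tau> \<in> I \<Longrightarrow> a - e2 < \<tau> \<Longrightarrow> \<tau> < a \<Longrightarrow>
        \<gamma>2 \<tau> = (fst (\<gamma>2 a) + of_real (\<tau> - a) * velocity (incoming (fst (\<gamma>2 a)) (snd (\<gamma>2 a))),
          incoming (fst (\<gamma>2 a)) (snd (\<gamma>2 a)))" by blast
    from orbit_step_dist[OF o1 a] obtain d1 where d1: "d1 > 0"
      "\<And>\<tau>. \<tau> \<in> I \<Longrightarrow> \<bar>\<tau> - a\<bar> < d1 \<Longrightarrow> cmod (fst (\<gamma>1 \<tau>) - fst (\<gamma>1 a)) = \<bar>\<tau> - a\<bar>" by blast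
    from orbit_step_dist[OF o2 a] obtain d2 where d2: "d2 > 0"
      "\<And>\<tau>. \<tau> \<in> I \<Longrightarrow> \<bar>\<tau> - a\<bar> < d2 \<Longrightarrow> cmod (fst (\<gamma>2 \<tau>) - fst (\<gamma>2 a)) = \<bar>\<tau> - a\<bar>" by blast
    define D where "D = cmod (fst (\<gamma>1 a) - fst (\<gamma>2 a))"
    \<comment> \<open>If the positions differ by \<open>D > 0\<close>, each orbit moves by less than
      \<open>D / 2\<close> within time \<open>e\<close>, so they cannot meet.\<close>
    define e where "e = Min ({e1, e2, d1, d2} \<union> (if D > 0 then {D / 2} else {}))"
    have e: "e > 0" "e \<le> e1" "e \<le> e2" "e \<le> d1" "e \<le> d2" "D > 0 \<Longrightarrow> e \<le> D / 2"
      using e1(1) e2(1) d1(1) d2(1) by (auto simp: e_def)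
    have "(\<gamma>1 a = \<gamma>2 a) = (\<gamma>1 \<tau> = \<gamma>2 \<tau>)" if \<tau>: "\<tau> \<in> I" "\<bar>\<tau> - a\<bar> < e" for \<tau>
    proof (cases "fst (\<gamma>1 a) = fst (\<gamma>2 a)")
      case True
      show ?thesis
      proof (cases "a \<le> \<tau>")
        case T: True
        then have "\<tau> < a + e1" "\<tau> < a + e2" using \<tau> e by linarith+
        then show ?thesis
          unfolding e1(2)[OF \<tau>(1) T \<open>\<tau> < a + e1\<close>] e2(2)[OF \<tau>(1) T \<open>\<tau> < a + e2\<close>] True prod_eq_iff fst_conv snd_conv
          by auto
      next
        case F: False
        then have "a - e1 < \<tau>" "a - e2 < \<tau>" "\<tau> < a" using \<tau> e by linarith+
        then show ?thesis
          unfolding e1(3)[OF \<tau>(1) \<open>a - e1 < \<tau>\<close> \<open>\<tau> < a\<close>] e2(3)[OF \<tau>(1) \<open>a - e2 < \<tau>\<close> \<open>\<tau> < a\<close>]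
            True prod_eq_iff fst_conv snd_conv incoming_eq_iff
          by (auto simp: True incoming_eq_iff)
      qed
    next
      case False
      then have "D > 0" by (simp add: D_def)
      have "\<gamma>1 \<tau> \<noteq> \<gamma>2 \<tau>"
      proof
        assume "\<gamma>1 \<tau> = \<gamma>2 \<tau>"
        then have "D \<le> cmod (fst (\<gamma>1 \<tau>) - fst (\<gamma>1 a)) + cmod (fst (\<gamma>2 \<tau>) - fst (\<gamma>2 a))"
          unfolding D_def
          using norm_triangle_ineq4[of "fst (\<gamma>1 \<tau>) - fst (\<gamma>2 a)" "fst (\<gamma>1 \<tau>) - fst (\<gamma>1 a)"] by simp
        also have "\<dots> < D" using d1(2)[OF \<tau>(1)] d2(2)[OF \<tau>(1)] \<tau>(2) e(4,5) e(6)[OF \<open>D > 0\<close>] by linarith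
        finally show False by simp
      qed
      then show ?thesis using False by auto
    qed
    then show "eventually (\<lambda>b. (\<gamma>1 a = \<gamma>2 a) = (\<gamma>1 b = \<gamma>2 b)) (at a within I)"
      unfolding eventually_at using e(1) by (auto simp: dist_real_def)
  qed
  then show ?thesis using eq by simp
qed

section \<open>The partial flow and states with a global orbit\<close>

lemma billiard_flow_eq_Some:
  "billiard_flow s g \<theta> t x = Some y \<longleftrightarrow>
     (\<exists>\<gamma>. orbit (closed_segment 0 t) \<gamma> \<and> \<gamma> 0 = x \<and> \<gamma> t = y)"
proof -
  have uniq: "y = y'" if "orbit (closed_segment 0 t) \<gamma> \<and> \<gamma> 0 = x \<and> \<gamma> t = y"
    "orbit (closed_segment 0 t) \<gamma>' \<and> \<gamma>' 0 = x \<and> \<gamma>' t = y'" for \<gamma> \<gamma>' y y'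
    using orbit_unique[of "closed_segment 0 t" 0 t \<gamma> \<gamma>'] that by auto
  show ?thesis
  proof (cases "\<exists>\<gamma>. orbit (closed_segment 0 t) \<gamma> \<and> \<gamma> 0 = x")
    case True
    then obtain y0 where y0: "\<exists>\<gamma>. orbit (closed_segment 0 t) \<gamma> \<and> \<gamma> 0 = x \<and> \<gamma> t = y0" by blast
    then have "(THE y. \<exists>\<gamma>. orbit (closed_segment 0 t) \<gamma> \<and> \<gamma> 0 = x \<and> \<gamma> t = y) = y0"
      using uniq by (intro the_equality) blast+
    then have "billiard_flow s g \<theta> t x = Some y0"
      unfolding billiard_flow_def if_P[OF True] by (rule arg_cong)
    then show ?thesis using y0 uniq by (metis option.inject)
  next
    case False
    then show ?thesis unfolding billiard_flow_def if_not_P[OF False] by blast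
  qed
qed

text \<open>The orbit condition covers both time directions, so the same orbit, with time shifted by
  \<open>t\<close>, leads back from \<open>y\<close> to \<open>x\<close> without reversing
  velocities.\<close>

lemma billiard_flow_inverse:
  assumes "billiard_flow s g \<theta> t x = Some y"
  shows "billiard_flow s g \<theta> (- t) y = Some x"
proof -
  obtain \<gamma> where \<gamma>: "orbit (closed_segment 0 t) \<gamma>" "\<gamma> 0 = x" "\<gamma> t = y"
    using assms unfolding billiard_flow_eq_Some by blast
  have "orbit (closed_segment 0 (- t)) (\<lambda>\<tau>. \<gamma> (\<tau> + t))"
    by (rule orbit_shift[OF \<gamma>(1)]) (auto simp: closed_segment_eq_real_ivl split: if_splits)
  then show ?thesis unfolding billiard_flow_eq_Some using \<gamma> by (intro exI[of _ "\<lambda>\<tau>. \<gamma> (\<tau> + t)"]) simp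
qed

lemma billiard_flow_space:
  assumes "billiard_flow s g \<theta> t x = Some y"
  shows "x \<in> table s g \<times> directions \<theta>" "y \<in> table s g \<times> directions \<theta>"
proof -
  obtain \<gamma> where \<gamma>: "orbit (closed_segment 0 t) \<gamma>" "\<gamma> 0 = x" "\<gamma> t = y"
    using assms unfolding billiard_flow_eq_Some by blast
  show "x \<in> table s g \<times> directions \<theta>"
    using orbit_state[OF \<gamma>(1), of 0] \<gamma>(2) by (simp add: mem_Times_iff)
  show "y \<in> table s g \<times> directions \<theta>"
    using orbit_state[OF \<gamma>(1), of t] \<gamma>(3) by (simp add: mem_Times_iff)
qed

lemma billiard_flow_orbit:
  assumes "orbit I \<gamma>" "closed_segment a (a + t) \<subseteq> I"
  shows "billiard_flow s g \<theta> t (\<gamma> a) = Some (\<gamma> (a + t))"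
proof -
  have "orbit (closed_segment 0 t) (\<lambda>\<tau>. \<gamma> (\<tau> + a))"
  proof (rule orbit_shift[OF assms(1)])
    fix \<tau> assume "\<tau> \<in> closed_segment 0 t"
    then have "\<tau> + a \<in> closed_segment a (a + t)"
      by (auto simp: closed_segment_eq_real_ivl split: if_splits)
    then show "\<tau> + a \<in> I" using assms(2) by blast
  qed
  then show ?thesis
    unfolding billiard_flow_eq_Some by (intro exI[of _ "\<lambda>\<tau>. \<gamma> (\<tau> + a)"]) (simp add: add.commute)
qed

definition regular :: "state set" where
  "regular = {\<Gamma> 0 |\<Gamma>. orbit UNIV \<Gamma>}"

lemma regular_cases:
  assumes "x \<in> regular"
  obtains \<Gamma> where "orbit UNIV \<Gamma>" "\<Gamma> 0 = x" "\<And>t. billiard_flow s g \<theta> t x = Some (\<Gamma> t)"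
proof -
  obtain \<Gamma> where \<Gamma>: "orbit UNIV \<Gamma>" "\<Gamma> 0 = x" using assms by (auto simp: regular_def)
  then show ?thesis using that billiard_flow_orbit[OF \<Gamma>(1), of 0] by simp
qed

lemma orbit_regular: "orbit UNIV \<Gamma> \<Longrightarrow> \<Gamma> a \<in> regular"
  using orbit_shift[of UNIV \<Gamma> UNIV a] unfolding regular_def
  by (intro CollectI exI[of _ "\<lambda>t. \<Gamma> (t + a)"]) simp

text \<open>Reduces existence of a two-sided orbit to countably many times, which makes the set of
  such states measurable. Uniqueness makes the flow values agree with every finite piece of orbit,
  so the pieces fit together.\<close>

lemma regularI:
  assumes def: "\<And>n::nat. billiard_flow s g \<theta> (real n) x \<noteq> None" "\<And>n::nat. billiard_flow s g \<theta> (- real n) x \<noteq> None"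
  shows "x \<in> regular"
proof -
  define \<Gamma> where "\<Gamma> t = the (billiard_flow s g \<theta> t x)" for t
  have ex: "\<exists>\<gamma>. orbit (closed_segment 0 T) \<gamma> \<and> (\<forall>t\<in>closed_segment 0 T. \<Gamma> t = \<gamma> t) \<and> \<gamma> 0 = x"
    if "billiard_flow s g \<theta> T x \<noteq> None" for T
  proof -
    obtain \<gamma> where \<gamma>: "orbit (closed_segment 0 T) \<gamma>" "\<gamma> 0 = x"
      using \<open>billiard_flow s g \<theta> T x \<noteq> None\<close> billiard_flow_eq_Some by fastforce
    have "billiard_flow s g \<theta> t x = Some (\<gamma> t)" if "t \<in> closed_segment 0 T" for t
      using billiard_flow_orbit[OF \<gamma>(1), of 0 t] \<gamma>(2) that by (simp add: subset_closed_segment)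
    then show ?thesis using \<gamma> by (intro exI[of _ \<gamma>]) (simp add: \<Gamma>_def)
  qed
  have "orbit_at UNIV \<Gamma> t" for t
  proof -
    obtain n where n: "real n > \<bar>t\<bar>" using reals_Archimedean2 by blast
    obtain \<gamma> where \<gamma>: "orbit {0..real n} \<gamma>" "\<And>t. 0 \<le> t \<Longrightarrow> t \<le> real n \<Longrightarrow> \<Gamma> t = \<gamma> t" "\<gamma> 0 = x"
      using ex[OF def(1)[of n]] by (auto simp: closed_segment_eq_real_ivl)
    obtain \<gamma>' where \<gamma>': "orbit {- real n..0} \<gamma>'" "\<And>t. - real n \<le> t \<Longrightarrow> t \<le> 0 \<Longrightarrow> \<Gamma> t = \<gamma>' t" "\<gamma>' 0 = x"
    proof -
      have "closed_segment 0 (- real n) = {- real n..0}" by (auto simp: closed_segment_eq_real_ivl)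
      then show ?thesis using that ex[OF def(2)[of n]] by auto
    qed
    consider "t > 0" | "t < 0" | "t = 0" by linarith
    then show ?thesis
    proof cases
      case 1
      show ?thesis
      proof (rule orbit_at_glue[where J = "\<lambda>_. {0..real n}" and \<gamma>' = "\<lambda>_. \<gamma>" and a = 0 and \<delta> = "min t (real n - t)"])
        show "orbit_at {0..real n} \<gamma> (t + 0)" using \<gamma>(1) n 1 unfolding orbit_iff by simp
      qed (use 1 n \<gamma>(2) in auto)
    next
      case 2
      show ?thesis
      proof (rule orbit_at_glue[where J = "\<lambda>_. {- real n..0}" and \<gamma>' = "\<lambda>_. \<gamma>'" and a = 0 and \<delta> = "min (- t) (real n + t)"])
        show "orbit_at {- real n..0} \<gamma>' (t + 0)" using \<gamma>'(1) n 2 unfolding orbit_iff by simp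
      qed (use 2 n \<gamma>'(2) in auto)
    next
      case 3
      \<comment> \<open>At time 0 neither piece suffices: the forward orbit controls only later
        times and the backward one only earlier times. The index \<open>b\<close> selects the piece
        according to the sign of \<open>\<tau>\<close>.\<close>
      show ?thesis
      proof (rule orbit_at_glue[where J = "\<lambda>b. if b then {0..real n} else {- real n..0}"
            and \<gamma>' = "\<lambda>b. if b then \<gamma> else \<gamma>'" and a = 0 and \<delta> = "real n"])
        show "orbit_at (if b then {0..real n} else {- real n..0}) (if b then \<gamma> else \<gamma>') (t + 0)" for b
          using \<gamma>(1) \<gamma>'(1) n 3 unfolding orbit_iff by simp
        show "(if b then \<gamma> else \<gamma>') (t + 0) = \<Gamma> t" for b
          using \<gamma>(2)[of 0] \<gamma>'(2)[of 0] 3 by simp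
        fix \<tau> assume "\<bar>\<tau> - t\<bar> < real n"
        then show "\<exists>b. \<tau> + 0 \<in> (if b then {0..real n} else {- real n..0}) \<and>
              \<Gamma> \<tau> = (if b then \<gamma> else \<gamma>') (\<tau> + 0)"
          using \<gamma>(2)[of \<tau>] \<gamma>'(2)[of \<tau>] 3 by (intro exI[of _ "\<tau> \<ge> 0"]) auto
      qed (use n 3 in auto)
    qed
  qed
  then have "orbit UNIV \<Gamma>" unfolding orbit_iff by blast
  moreover have "\<Gamma> 0 = x"
    using ex[OF def(1)[of 0]] by auto
  ultimately show ?thesis unfolding regular_def by blast
qed

text \<open>At a collision the state carries the outgoing direction, so the direction jumps from the
  left only and is constant for a short time afterwards. Hence continuity of \<open>f\<close> in the
  position, for each fixed direction, is enough.\<close>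

lemma orbit_right_continuous:
  fixes f :: "state \<Rightarrow> 'b::topological_space"
  assumes \<Gamma>: "orbit UNIV \<Gamma>" and cont: "\<And>u. continuous_on UNIV (\<lambda>p. f (p, u))"
  shows "continuous (at_right t) (\<lambda>t. f (\<Gamma> t))"
proof -
  from orbit_local[OF \<Gamma> UNIV_I, of t] obtain \<epsilon> where \<epsilon>: "\<epsilon> > 0"
    "\<And>\<tau>. \<tau> \<in> UNIV \<Longrightarrow> t \<le> \<tau> \<Longrightarrow> \<tau> < t + \<epsilon> \<Longrightarrow>
      \<Gamma> \<tau> = (fst (\<Gamma> t) + of_real (\<tau> - t) * velocity (snd (\<Gamma> t)), snd (\<Gamma> t))"
    "\<And>\<tau>. \<tau> \<in> UNIV \<Longrightarrow> t - \<epsilon> < \<tau> \<Longrightarrow> \<tau> < t \<Longrightarrow>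
      \<Gamma> \<tau> = (fst (\<Gamma> t) + of_real (\<tau> - t) * velocity (incoming (fst (\<Gamma> t)) (snd (\<Gamma> t))),
        incoming (fst (\<Gamma> t)) (snd (\<Gamma> t)))" by blast
  let ?h = "\<lambda>\<tau>. f (fst (\<Gamma> t) + of_real (\<tau> - t) * velocity (snd (\<Gamma> t)), snd (\<Gamma> t))"
  have "continuous_on UNIV ?h"
    by (rule continuous_on_compose2[OF cont[of "snd (\<Gamma> t)"]]) (auto intro!: continuous_intros)
  then have "isCont ?h t" by (simp add: continuous_on_eq_continuous_at)
  then have "(?h \<longlongrightarrow> ?h t) (at_right t)"
    using continuous_at_imp_continuous_at_within[of t ?h "{t<..}"] by (simp only: continuous_within)
  moreover have "eventually (\<lambda>\<tau>. ?h \<tau> = f (\<Gamma> \<tau>)) (at_right t)"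
    unfolding eventually_at_right_field
  proof (intro exI[of _ "t + \<epsilon>"] conjI allI impI)
    fix \<tau> assume "t < \<tau>" "\<tau> < t + \<epsilon>"
    then have "\<Gamma> \<tau> = (fst (\<Gamma> t) + of_real (\<tau> - t) * velocity (snd (\<Gamma> t)), snd (\<Gamma> t))"
      by (intro \<epsilon>(2)) auto
    then show "?h \<tau> = f (\<Gamma> \<tau>)" by (rule arg_cong[OF sym])
  qed (use \<epsilon>(1) in simp)
  ultimately have lim: "((\<lambda>\<tau>. f (\<Gamma> \<tau>)) \<longlongrightarrow> ?h t) (at_right t)"
    by (rule Lim_transform_eventually)
  have "?h t = f (\<Gamma> t)" by simp
  from lim[unfolded this] show ?thesis unfolding continuous_within .
qed

text \<open>While it stays in the ball, the straight line through the state is itself an orbit, so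
  uniqueness identifies it with the given one.\<close>

lemma orbit_straight:
  assumes \<Gamma>: "orbit UNIV \<Gamma>" and ball: "ball (fst (\<Gamma> t)) r \<subseteq> interior (table s g)" and \<tau>: "\<bar>\<tau> - t\<bar> < r"
  shows "\<Gamma> \<tau> = (fst (\<Gamma> t) + of_real (\<tau> - t) * velocity (snd (\<Gamma> t)), snd (\<Gamma> t))"
proof -
  define p u where "p = fst (\<Gamma> t)" and "u = snd (\<Gamma> t)"
  define I where "I = {t - r<..<t + r}"
  define L where "L \<tau> = (p + of_real (\<tau> - t) * velocity u, u)" for \<tau>
  have u: "u \<in> directions \<theta>" using orbit_state(2)[OF \<Gamma>] by (simp add: u_def)
  have "orbit_at I L a" if "a \<in> I" for a
  proof -
    have "cmod (of_real (a - t) * velocity u) = \<bar>a - t\<bar>"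
      using norm_velocity[OF norm_directions[OF u]] by (simp add: norm_mult del: of_real_diff)
    then have int: "fst (L a) \<in> interior (table s g)"
      using ball that by (auto simp: L_def p_def I_def dist_norm abs_less_iff)
    have "fst (L a) \<notin> tree s z" if "z \<in> g" for z
      using tree_disjoint_interior_table[OF that] int by blast
    then have out: "fst (L a) \<notin> corners s z" "fst (L a) \<notin> frontier (tree s z)" if "z \<in> g" for z
      using that corners_subset_tree[OF s_pos] frontier_subset_closed[OF closed_tree] by blast+
    have L_line: "L \<tau> = (fst (L a) + of_real (\<tau> - a) * velocity (snd (L a)), snd (L a))" for \<tau>
      by (simp add: L_def algebra_simps)
    show ?thesis
      unfolding orbit_at_def
    proof (intro conjI ballI impI)
      show "fst (L a) \<in> table s g" using int interior_subset by blast
      show "snd (L a) \<in> directions \<theta>" using u by (simp add: L_def)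
      show "\<exists>\<epsilon>>0. \<forall>\<tau>\<in>I. \<bar>\<tau> - a\<bar> < \<epsilon> \<longrightarrow>
           L \<tau> = (fst (L a) + of_real (\<tau> - a) * velocity (snd (L a)), snd (L a))"
        by (intro exI[of _ "1::real"] conjI ballI impI L_line) simp
    qed (use out in blast)+
  qed
  then have L: "orbit I L" unfolding orbit_iff by blast
  have "r > 0" using \<tau> by linarith
  then have "t \<in> I" "\<tau> \<in> I" using \<tau> by (auto simp: I_def abs_less_iff)
  moreover have "connected I" by (simp add: I_def)
  ultimately have "\<Gamma> \<tau> = L \<tau>"
    using orbit_unique[OF _ _ _ orbit_subset[OF \<Gamma> subset_UNIV] L, of t \<tau>] by (simp add: L_def p_def u_def)
  then show ?thesis by (simp add: L_def p_def u_def)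
qed

end

section \<open>Measure-theoretic preliminaries\<close>

text \<open>The exponent 3 exceeds the dimension 2: on dyadic discs the weight decays like
  \<open>8^(-n)\<close> while the area grows like \<open>4^n\<close>, leaving a geometric series of
  ratio \<open>1/2\<close>.\<close>

lemma nn_integral_inverse_cube:
  "(\<integral>\<^sup>+z. ennreal (1 / max 1 (cmod z ^ 3)) \<partial>lborel) < \<infinity>"
proof -
  define V where "V = unit_ball_vol 2"
  have V: "V \<ge> 0" by (simp add: V_def)
  have pow8: "(8::real) ^ n = 2 ^ n * 2 ^ n * 2 ^ n" for n
    by (simp only: power_mult_distrib[symmetric]) simp
  have "(\<integral>\<^sup>+z. ennreal (1 / max 1 (cmod z ^ 3)) \<partial>lborel)
    \<le> (\<integral>\<^sup>+(z::complex). (\<Sum>n. ennreal ((1/8) ^ n) * indicator (cball 0 (2 ^ Suc n)) z) \<partial>lborel)"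
  proof (intro nn_integral_mono)
    fix z :: complex
    \<comment> \<open>Minimality gives \<open>cmod z > 2^n\<close> unless \<open>n = 0\<close>,
      where the bound is just that the weight is at most 1.\<close>
    define n where "n = (LEAST n. cmod z \<le> 2 ^ Suc n)"
    obtain m :: nat where "cmod z < 2 ^ m" using real_arch_pow[of 2 "cmod z"] by auto
    also have "(2::real) ^ m \<le> 2 ^ Suc m" by simp
    finally have ex: "\<exists>m. cmod z \<le> 2 ^ Suc m" using less_imp_le by blast
    have n: "cmod z \<le> 2 ^ Suc n" unfolding n_def by (rule LeastI_ex[OF ex])
    have "1 / max 1 (cmod z ^ 3) \<le> (1 / 8) ^ n"
    proof (cases n)
      case (Suc k)
      then have "2 ^ n < cmod z" using not_less_Least[of k "\<lambda>n. cmod z \<le> 2 ^ Suc n"] by (simp add: n_def)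
      then have "(2 ^ n) ^ 3 \<le> cmod z ^ 3" by (intro power_mono) auto
      also have "((2::real) ^ n) ^ 3 = 8 ^ n" unfolding pow8 by (simp add: power3_eq_cube)
      finally have "8 ^ n \<le> max 1 (cmod z ^ 3)" by simp
      then show ?thesis by (simp add: power_one_over frac_le)
    qed simp
    then have "ennreal (1 / max 1 (cmod z ^ 3)) \<le> ennreal ((1/8) ^ n) * indicator (cball 0 (2 ^ Suc n)) z"
      using n by (simp add: ennreal_leI)
    also have "\<dots> = (\<Sum>k\<in>{n}. ennreal ((1/8) ^ k) * indicator (cball 0 (2 ^ Suc k)) z)"
      by (simp only: sum.insert finite.emptyI empty_iff not_False_eq_True sum.empty add_0_right)
    also have "\<dots> \<le> (\<Sum>n. ennreal ((1/8) ^ n) * indicator (cball 0 (2 ^ Suc n)) z)"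
      by (rule sum_le_suminf) (auto intro: summableI)
    finally show "ennreal (1 / max 1 (cmod z ^ 3)) \<le> \<dots>" .
  qed
  also have "\<dots> = (\<Sum>n. \<integral>\<^sup>+z. ennreal ((1/8) ^ n) * indicator (cball 0 (2 ^ Suc n)) (z::complex) \<partial>lborel)"
    by (intro nn_integral_suminf borel_measurable_times_ennreal borel_measurable_const borel_measurable_indicator) simp
  also have "\<dots> = (\<Sum>n. ennreal (4 * V * (1/2) ^ n))"
  proof (intro suminf_cong)
    fix n :: nat
    have "(\<integral>\<^sup>+z. ennreal ((1/8) ^ n) * indicator (cball 0 (2 ^ Suc n)) (z::complex) \<partial>lborel)
      = ennreal ((1/8) ^ n) * ennreal (V * (2 ^ Suc n)\<^sup>2)"
      by (subst nn_integral_cmult_indicator) (simp_all add: emeasure_cball V_def del: power_Suc)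
    also have "\<dots> = ennreal ((1/8) ^ n * (V * (2 ^ Suc n)\<^sup>2))"
      using V by (simp add: ennreal_mult)
    also have "(1/8) ^ n * (V * (2 ^ Suc n)\<^sup>2) = 4 * V * ((1/8) ^ n * ((2 ^ n)\<^sup>2))"
      by (simp add: power2_eq_square)
    also have "(1/8::real) ^ n * ((2 ^ n)\<^sup>2) = (1/2) ^ n"
      using pow8[of n] by (simp add: power2_eq_square power_one_over field_simps)
    finally show "(\<integral>\<^sup>+z. ennreal ((1/8) ^ n) * indicator (cball 0 (2 ^ Suc n)) (z::complex) \<partial>lborel)
      = ennreal (4 * V * (1/2) ^ n)" .
  qed
  also have "\<dots> < \<infinity>"
  proof -
    have "(\<Sum>n. ennreal (4 * V * (1/2) ^ n)) \<noteq> top"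
      using V by (intro ennreal_suminf_neq_top summable_mult summable_geometric) auto
    then show ?thesis by (simp add: less_top)
  qed
  finally show ?thesis .
qed

text \<open>The time is replaced by a grid point to its right, so that only countably many of the
  measurable functions \<open>h t\<close> occur, and the grid is refined.\<close>

lemma right_continuous_joint_measurable:
  fixes h :: "real \<Rightarrow> 'a \<Rightarrow> real"
  assumes [measurable]: "\<And>t. h t \<in> borel_measurable M"
    and cont: "\<And>x t. x \<in> space M \<Longrightarrow> continuous (at_right t) (\<lambda>t. h t x)"
  shows "(\<lambda>(t, x). h t x) \<in> borel_measurable (lborel \<Otimes>\<^sub>M M)"
proof -
  \<comment> \<open>The \<open>+ 1\<close> after the floor puts the grid point strictly to the right
    of \<open>t\<close>, as the filter \<open>at_right\<close> requires.\<close>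
  define a where "a n t = (of_int \<lfloor>t * real (Suc n)\<rfloor> + 1) / real (Suc n)" for n :: nat and t :: real
  have a_gt: "t < a n t" for n t
  proof -
    have "t * real (Suc n) < of_int \<lfloor>t * real (Suc n)\<rfloor> + 1" by linarith
    then show ?thesis unfolding a_def by (simp add: pos_less_divide_eq del: of_nat_Suc)
  qed
  have a_le: "a n t \<le> t + 1 / real (Suc n)" for n t
    unfolding a_def add_divide_distrib by (simp add: pos_divide_le_eq del: of_nat_Suc)
  have lim: "(\<lambda>n. h (a n t) x) \<longlonglongrightarrow> h t x" if "x \<in> space M" for t x
  proof -
    have up: "(\<lambda>n. t + 1 / real (Suc n)) \<longlonglongrightarrow> t + 0"
      using LIMSEQ_inverse_real_of_nat by (intro tendsto_add tendsto_const) (simp add: inverse_eq_divide)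
    have "(\<lambda>n. a n t) \<longlonglongrightarrow> t"
    proof (rule tendsto_sandwich[OF _ _ tendsto_const[of t]])
      show "(\<lambda>n. t + 1 / real (Suc n)) \<longlonglongrightarrow> t" using up by simp
    qed (use a_gt a_le less_imp_le in \<open>blast intro: always_eventually\<close>)+
    then have "filterlim (\<lambda>n. a n t) (at_right t) sequentially"
      unfolding filterlim_at using a_gt by (simp add: less_imp_neq[symmetric])
    moreover have "((\<lambda>t. h t x) \<longlongrightarrow> h t x) (at_right t)"
      using cont[OF that] by (simp add: continuous_within)
    ultimately show ?thesis by (rule filterlim_compose[rotated])
  qed
  show ?thesis
  proof (rule borel_measurable_LIMSEQ_real)
    fix p :: "real \<times> 'a" assume "p \<in> space (lborel \<Otimes>\<^sub>M M)"
    then show "(\<lambda>n. h (a n (fst p)) (snd p)) \<longlonglongrightarrow> (case p of (t, x) \<Rightarrow> h t x)"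
      using lim by (auto simp: space_pair_measure)
  next
    fix n
    have "(\<lambda>p::real \<times> 'a. (\<lambda>i p. h ((of_int i + 1) / real (Suc n)) (snd p)) \<lfloor>fst p * real (Suc n)\<rfloor> p)
        \<in> borel_measurable (lborel \<Otimes>\<^sub>M M)"
      by (rule measurable_compose_countable) measurable
    then show "(\<lambda>p. h (a n (fst p)) (snd p)) \<in> borel_measurable (lborel \<Otimes>\<^sub>M M)"
      by (simp add: a_def)
  qed
qed

text \<open>A one-fold product consists of functions on \<open>{0}\<close>, not of points. The map
  \<open>e\<close> identifies sets with their cylinders, respects measure and set operations, and
  intertwines the two image operators.\<close>

lemma ergodic_flow_of_power_1:
  fixes m :: "'a measure"
  assumes "sigma_finite_measure m" and erg: "ergodic_flow (power_measure 1 m) (power_flow 1 \<psi>)"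
    and space: "\<And>t x y. \<psi> t x = Some y \<Longrightarrow> y \<in> space m"
  shows "ergodic_flow m \<psi>"
proof -
  interpret product_sigma_finite "\<lambda>_::nat. m"
    using assms(1) by (simp add: product_sigma_finite_def)
  define P where "P = power_measure 1 m"
  have P: "P = PiM {..<1::nat} (\<lambda>_. m)" by (simp add: P_def power_measure_def)
  define e where "e = (\<lambda>B::'a set. PiE {..<1::nat} (\<lambda>_. B))"
  have one: "{..<1::nat} = {0}" by auto
  have e_mem: "x \<in> e B \<longleftrightarrow> x \<in> extensional {0} \<and> x 0 \<in> B" for x B
    unfolding e_def one by (auto simp: PiE_def)
  have e_sets: "e B \<in> sets P" if "B \<in> sets m" for B
    unfolding e_def P using that by (intro sets_PiM_I_finite) auto
  have e_emeasure: "emeasure P (e B) = emeasure m B" if "B \<in> sets m" for B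
    unfolding e_def P using that by (subst emeasure_PiM) (auto simp: one)
  have e_inj: "A = B" if "e A = e B" for A B
  proof -
    have "y \<in> A \<longleftrightarrow> y \<in> B" for y
      using that e_mem[of "\<lambda>k\<in>{0}. y" A] e_mem[of "\<lambda>k\<in>{0}. y" B] by simp
    then show ?thesis by blast
  qed
  \<comment> \<open>Flow images are known to be measurable only in the product; measurability
    descends by pulling back along the embedding of points as constant functions on
    \<open>{0}\<close>.\<close>
  have e_sets_iff: "B \<in> sets m" if "e B \<in> sets P" "B \<subseteq> space m" for B
  proof -
    have "(\<lambda>y. \<lambda>k\<in>{..<1::nat}. y) \<in> m \<rightarrow>\<^sub>M P" unfolding P by measurable
    from measurable_sets[OF this that(1)] have "(\<lambda>y. \<lambda>k\<in>{..<1::nat}. y) -` e B \<inter> space m \<in> sets m" .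
    moreover have "(\<lambda>y. \<lambda>k\<in>{..<1::nat}. y) -` e B \<inter> space m = B"
      using that(2) by (auto simp: e_mem one)
    ultimately show ?thesis by simp
  qed
  have e_flow: "flow_image (power_flow 1 \<psi>) t (e B) = e (flow_image \<psi> t B)" for t B
  proof (intro set_eqI iffI)
    fix y assume "y \<in> flow_image (power_flow 1 \<psi>) t (e B)"
    then show "y \<in> e (flow_image \<psi> t B)"
      by (auto simp: flow_image_def power_flow_def e_mem one split: if_splits)
  next
    fix y assume y: "y \<in> e (flow_image \<psi> t B)"
    then obtain x where x: "x \<in> B" "\<psi> t x = Some (y 0)" by (auto simp: e_mem flow_image_def)
    have "power_flow 1 \<psi> t (\<lambda>k\<in>{0}. x) = Some (\<lambda>k\<in>{0}. y 0)"
      unfolding power_flow_def one using x(2) by (auto simp: fun_eq_iff)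
    also have "(\<lambda>k\<in>{0}. y 0) = y" using y by (auto simp: e_mem extensional_def)
    finally have "power_flow 1 \<psi> t (\<lambda>k\<in>{0}. x) = Some y" .
    moreover have "(\<lambda>k\<in>{0}. x) \<in> e B" using x(1) by (simp add: e_mem)
    ultimately show "y \<in> flow_image (power_flow 1 \<psi>) t (e B)" by (auto simp: flow_image_def)
  qed
  have flow_sub: "flow_image \<psi> t B \<subseteq> space m" for t B
    using space by (auto simp: flow_image_def)
  have pres: "flow_image \<psi> t B \<in> sets m \<and> emeasure m (flow_image \<psi> t B) = emeasure m B"
    if B: "B \<in> sets m" for t B
  proof -
    have "e (flow_image \<psi> t B) \<in> sets P" "emeasure P (e (flow_image \<psi> t B)) = emeasure P (e B)"
      using erg e_sets[OF B] unfolding ergodic_flow_def measure_preserving_flow_def e_flow[symmetric] P_def by blast+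
    then show ?thesis using e_sets_iff[OF _ flow_sub] e_emeasure B by metis
  qed
  have "B \<in> null_sets m \<or> space m - B \<in> null_sets m"
    if B: "B \<in> sets m" and inv: "\<And>t. sym_diff (flow_image \<psi> t B) B \<in> null_sets m" for B
  proof -
    have diff: "e A - e A' = e (A - A')" "e A \<union> e A' = e (A \<union> A')" for A A'
      by (auto simp: e_mem)
    have null_iff: "e A \<in> null_sets P \<longleftrightarrow> A \<in> null_sets m" if "A \<in> sets m" for A
      using that e_sets e_emeasure by (simp add: null_sets_def)
    have "sym_diff (flow_image (power_flow 1 \<psi>) t (e B)) (e B) \<in> null_sets P" for t
      unfolding e_flow diff using null_iff inv[of t] by blast
    then have "e B \<in> null_sets P \<or> space P - e B \<in> null_sets P"
      using erg e_sets[OF B] unfolding ergodic_flow_def P_def by blast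
    moreover have "space P = e (space m)" unfolding P e_def by (simp add: space_PiM)
    ultimately show ?thesis unfolding diff using null_iff B by (metis \<open>space P = e (space m)\<close> diff(1) sets.compl_sets)
  qed
  then show ?thesis using pres unfolding ergodic_flow_def measure_preserving_flow_def by blast
qed

lemma AE_power_measure:
  assumes "sigma_finite_measure m" and P: "AE x in m. P x"
  shows "AE x in power_measure K m. \<forall>k<K. P (x k)"
proof -
  interpret product_sigma_finite "\<lambda>_::nat. m"
    using assms(1) by (simp add: product_sigma_finite_def)
  obtain N where N: "{x\<in>space m. \<not> P x} \<subseteq> N" "N \<in> null_sets m"
    using P unfolding eventually_ae_filter by blast
  have "AE x in power_measure K m. P (x k)" if k: "k < K" for k
  proof -
    let ?A = "PiE {..<K} (\<lambda>i. if i = k then N else space m)"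
    have "emeasure (power_measure K m) ?A = (\<Prod>i<K. emeasure m (if i = k then N else space m))"
      unfolding power_measure_def using N by (intro emeasure_PiM) auto
    \<comment> \<open>One null factor annihilates the product even where the other factors are
      infinite.\<close>
    also have "\<dots> = 0" using k N by (intro prod_zero) (auto intro!: bexI[of _ k])
    finally have "?A \<in> null_sets (power_measure K m)"
      unfolding power_measure_def null_sets_def using N by (auto intro!: sets_PiM_I_finite)
    then show ?thesis
      by (rule AE_I') (use N k in \<open>auto simp: power_measure_def space_PiM PiE_def Pi_def\<close>)
  qed
  then have "AE x in power_measure K m. \<forall>k\<in>{..<K}. P (x k)"
    by (subst AE_ball_countable) auto
  then show ?thesis by eventually_elim auto
qed

section \<open>The one-particle billiard flow\<close>

definition cube_weight :: "complex \<Rightarrow> state \<Rightarrow> real" where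
  "cube_weight i x = (if snd x = i then 1 / max 1 (cmod (fst x) ^ 3) else 0)"

lemma cube_weight_bounds: "0 \<le> cube_weight i x" "cube_weight i x \<le> 1"
  by (auto simp: cube_weight_def)

lemma f_hat_eq_sum: "f_hat K i x = (\<Sum>k<K. cube_weight i (x k))"
proof -
  have "{k. k < K \<and> snd (x k) = i} = {..<K} \<inter> {k. snd (x k) = i}" by auto
  then show ?thesis by (simp add: f_hat_def cube_weight_def sum.inter_restrict)
qed

lemma continuous_cube_weight: "continuous_on UNIV (\<lambda>p. cube_weight i (p, u))"
proof (cases "u = i")
  case True
  then show ?thesis by (auto simp: cube_weight_def intro!: continuous_intros)
qed (simp add: cube_weight_def)

context wind_tree
begin

abbreviation m :: "state measure" where "m \<equiv> phase_measure s g \<theta>"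

lemma space_m: "space m = table s g \<times> directions \<theta>"
  by (simp add: phase_measure_def space_pair_measure space_restrict_space)

lemma sets_table[measurable]: "table s g \<in> sets borel"
  using closed_table by simp

lemma sigma_finite_table: "sigma_finite_measure (restrict_space lborel (table s g) :: complex measure)"
  by (intro sigma_finite_measure_restrict_space sigma_finite_lborel) simp

lemma sigma_finite_directions: "sigma_finite_measure (count_space (directions \<theta>))"
  by (intro sigma_finite_measure_count_space_finite finite_directions)

lemma sigma_finite_m: "sigma_finite_measure m"
  unfolding phase_measure_def by (intro sigma_finite_pair_measure sigma_finite_table sigma_finite_directions)

lemma fst_measurable_m[measurable]: "fst \<in> m \<rightarrow>\<^sub>M borel"
proof -
  have "fst \<in> m \<rightarrow>\<^sub>M restrict_space lborel (table s g)" unfolding phase_measure_def by measurable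
  moreover have "(\<lambda>x. x) \<in> restrict_space lborel (table s g) \<rightarrow>\<^sub>M borel"
    by (rule measurable_restrict_space1) simp
  ultimately show ?thesis using measurable_compose[of fst m _ "\<lambda>x. x"] by blast
qed

lemma snd_measurable_m[measurable]: "snd \<in> m \<rightarrow>\<^sub>M count_space (directions \<theta>)"
  unfolding phase_measure_def by measurable

lemma sets_m_rectangle:
  assumes "A \<in> sets borel"
  shows "(A \<times> {j}) \<inter> space m \<in> sets m"
proof -
  have "{x \<in> space m. fst x \<in> A \<and> snd x = j} \<in> sets m" using assms by measurable
  moreover have "{x \<in> space m. fst x \<in> A \<and> snd x = j} = (A \<times> {j}) \<inter> space m" by auto
  ultimately show ?thesis by simp
qed

lemma cube_weight_measurable[measurable]: "cube_weight i \<in> borel_measurable m"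
  unfolding cube_weight_def by measurable

lemma nn_integral_m_direction:
  assumes h[measurable]: "h \<in> borel_measurable borel" and j: "j \<in> directions \<theta>"
  shows "(\<integral>\<^sup>+x. (if snd x = j then h (fst x) else 0) \<partial>m) = (\<integral>\<^sup>+z\<in>table s g. h z \<partial>lborel)"
proof -
  interpret D: sigma_finite_measure "count_space (directions \<theta>)" by (rule sigma_finite_directions)
  have "(\<lambda>x. if snd x = j then h (fst x) else 0) \<in> borel_measurable m" by measurable
  then have "(\<integral>\<^sup>+x. (if snd x = j then h (fst x) else 0) \<partial>m) =
     (\<integral>\<^sup>+z. \<integral>\<^sup>+u. (if u = j then h z else 0) \<partial>count_space (directions \<theta>) \<partial>restrict_space lborel (table s g))"
    unfolding phase_measure_def by (subst D.nn_integral_fst[symmetric]) (simp_all only: fst_conv snd_conv)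
  also have "\<dots> = (\<integral>\<^sup>+z. h z \<partial>restrict_space lborel (table s g))"
    using j finite_directions by (intro nn_integral_cong) (simp add: nn_integral_count_space_finite)
  also have "\<dots> = (\<integral>\<^sup>+z\<in>table s g. h z \<partial>lborel)"
    by (intro nn_integral_restrict_space) simp
  finally show ?thesis .
qed

lemma emeasure_m_rectangle:
  assumes A[measurable]: "A \<in> sets borel" and j: "j \<in> directions \<theta>"
  shows "emeasure m ((A \<times> {j}) \<inter> space m) = emeasure lborel (A \<inter> table s g)"
proof -
  have "emeasure m ((A \<times> {j}) \<inter> space m) = (\<integral>\<^sup>+x. indicator ((A \<times> {j}) \<inter> space m) x \<partial>m)"
    using sets_m_rectangle[OF A] by simp
  also have "\<dots> = (\<integral>\<^sup>+x. (if snd x = j then indicator A (fst x) else 0) \<partial>m)"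
    by (intro nn_integral_cong) (auto simp: indicator_def)
  also have "\<dots> = (\<integral>\<^sup>+z\<in>table s g. indicator A z \<partial>lborel)"
    by (rule nn_integral_m_direction[OF _ j]) simp
  also have "\<dots> = (\<integral>\<^sup>+z. indicator (A \<inter> table s g) z \<partial>lborel)"
    by (intro nn_integral_cong) (auto simp: indicator_def)
  finally show ?thesis by simp
qed

end

locale ergodic_wind_tree = wind_tree +
  assumes ergodic_m: "ergodic_flow m (billiard_flow s g \<theta>)"
begin

abbreviation \<psi> where "\<psi> \<equiv> billiard_flow s g \<theta>"

section \<open>Nullity of the states without a global orbit\<close>

lemma flow_image_m: "B \<in> sets m \<Longrightarrow> flow_image \<psi> t B \<in> sets m"
  "B \<in> sets m \<Longrightarrow> emeasure m (flow_image \<psi> t B) = emeasure m B"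
  using ergodic_m unfolding ergodic_flow_def measure_preserving_flow_def by blast+

text \<open>Invertibility turns the domain of a time map into an image of the whole space, and
  images are measurable by hypothesis.\<close>

lemma domain_flow: "{x \<in> space m. \<psi> t x \<noteq> None} = flow_image \<psi> (- t) (space m)"
proof (intro set_eqI iffI)
  fix x assume "x \<in> {x \<in> space m. \<psi> t x \<noteq> None}"
  then obtain y where "\<psi> t x = Some y" by auto
  then show "x \<in> flow_image \<psi> (- t) (space m)"
    using billiard_flow_inverse billiard_flow_space unfolding flow_image_def space_m by blast
next
  fix x assume "x \<in> flow_image \<psi> (- t) (space m)"
  then obtain y where "\<psi> (- t) y = Some x" by (auto simp: flow_image_def)
  then show "x \<in> {x \<in> space m. \<psi> t x \<noteq> None}"
    using billiard_flow_inverse[of "- t" y x] billiard_flow_space[of "- t" y x] by (simp add: space_m)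
qed

text \<open>The states at which the time map is undefined have empty image, but images have the
  measure of the original set. Thus the set is null without any count of the orbits that run into
  corners.\<close>

lemma AE_flow_defined: "AE x in m. \<psi> t x \<noteq> None"
proof -
  let ?N = "space m - flow_image \<psi> (- t) (space m)"
  have N: "?N \<in> sets m" using flow_image_m(1)[of "space m"] by auto
  moreover have "flow_image \<psi> t ?N = {}"
    unfolding domain_flow[symmetric] by (auto simp: flow_image_def)
  ultimately have "?N \<in> null_sets m" using flow_image_m(2)[OF N, of t] by (simp add: null_sets_def)
  then show ?thesis
    by (rule AE_I') (auto simp: domain_flow[symmetric])
qed

lemma regular_eq: "regular = (\<Inter>n::nat. {x \<in> space m. \<psi> (real n) x \<noteq> None} \<inter> {x \<in> space m. \<psi> (- real n) x \<noteq> None})"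
proof (intro set_eqI iffI)
  fix x assume "x \<in> regular"
  then obtain \<Gamma> where \<Gamma>: "\<And>t. \<psi> t x = Some (\<Gamma> t)" using regular_cases by metis
  moreover have "x \<in> space m" using billiard_flow_space(1)[OF \<Gamma>[of 0]] by (simp add: space_m)
  ultimately show "x \<in> (\<Inter>n::nat. {x \<in> space m. \<psi> (real n) x \<noteq> None} \<inter> {x \<in> space m. \<psi> (- real n) x \<noteq> None})"
    by simp
qed (auto intro!: regularI)

lemma regular_sets[measurable]: "regular \<in> sets m"
  unfolding regular_eq domain_flow using flow_image_m(1) by (intro sets.countable_INT' sets.Int) auto

lemma AE_regular: "AE x in m. x \<in> regular"
proof -
  have "AE x in m. \<forall>n::nat. \<psi> (real n) x \<noteq> None \<and> \<psi> (- real n) x \<noteq> None"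
    unfolding AE_all_countable using AE_flow_defined by (auto intro: AE_conjI)
  then show ?thesis by eventually_elim (auto intro!: regularI)
qed

section \<open>The total flow on regular states\<close>

definition m0 :: "state measure" where "m0 = restrict_space m regular"

definition \<phi> :: "real \<Rightarrow> state \<Rightarrow> state" where "\<phi> t x = the (\<psi> t x)"

lemma regular_space: "x \<in> regular \<Longrightarrow> x \<in> space m"
  using regular_sets sets.sets_into_space by blast

lemma space_m0: "space m0 = regular"
  by (simp add: m0_def)

lemma sets_m0: "A \<in> sets m0 \<longleftrightarrow> A \<subseteq> regular \<and> A \<in> sets m"
  unfolding m0_def by (subst sets_restrict_space_iff) auto

lemma emeasure_m0: "A \<subseteq> regular \<Longrightarrow> emeasure m0 A = emeasure m A"
  unfolding m0_def by (subst emeasure_restrict_space) auto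

lemma null_sets_m0: "A \<in> null_sets m0 \<longleftrightarrow> A \<subseteq> regular \<and> A \<in> null_sets m"
  using sets_m0 emeasure_m0 by (auto simp: null_sets_def)

lemma regular_orbit:
  assumes "x \<in> regular"
  obtains \<Gamma> where "orbit UNIV \<Gamma>" "\<Gamma> 0 = x" "\<And>t. \<psi> t x = Some (\<phi> t x)" "\<And>t. \<phi> t x = \<Gamma> t"
  using regular_cases[OF assms] that unfolding \<phi>_def by (metis option.sel)

lemma \<phi>_regular: "x \<in> regular \<Longrightarrow> \<phi> t x \<in> regular"
  using regular_orbit orbit_regular by metis

lemma \<phi>_add: "x \<in> regular \<Longrightarrow> \<phi> a (\<phi> t x) = \<phi> (a + t) x"
proof -
  assume "x \<in> regular"
  then obtain \<Gamma> where \<Gamma>: "orbit UNIV \<Gamma>" "\<Gamma> 0 = x" "\<And>t. \<phi> t x = \<Gamma> t" by (metis regular_orbit)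
  have "\<psi> a (\<Gamma> t) = Some (\<Gamma> (t + a))" by (rule billiard_flow_orbit[OF \<Gamma>(1)]) simp
  then have "\<phi> a (\<Gamma> t) = \<Gamma> (t + a)" by (simp add: \<phi>_def)
  then show ?thesis using \<Gamma>(3) by (simp add: add.commute)
qed

lemma \<phi>_0: "x \<in> regular \<Longrightarrow> \<phi> 0 x = x"
  using regular_orbit by metis

text \<open>Translates between the hypothesis, which speaks of images under the partial flow, and
  measurability and push-forward, which speak of preimages under the total one.\<close>

lemma \<phi>_vimage:
  assumes "B \<subseteq> regular"
  shows "\<phi> t -` B \<inter> regular = flow_image \<psi> (- t) B"
proof (intro set_eqI iffI)
  fix x assume x: "x \<in> \<phi> t -` B \<inter> regular"
  then have "\<psi> t x = Some (\<phi> t x)" using regular_orbit by (metis IntD2)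
  then show "x \<in> flow_image \<psi> (- t) B"
    using billiard_flow_inverse[of t x "\<phi> t x"] x unfolding flow_image_def by blast
next
  fix x assume "x \<in> flow_image \<psi> (- t) B"
  then obtain y where y: "y \<in> B" "\<psi> (- t) y = Some x" by (auto simp: flow_image_def)
  then have "\<phi> (- t) y = x" by (simp add: \<phi>_def)
  then have "x \<in> regular" using \<phi>_regular y(1) assms by blast
  moreover have "\<phi> t x = y" using billiard_flow_inverse[OF y(2)] by (simp add: \<phi>_def)
  ultimately show "x \<in> \<phi> t -` B \<inter> regular" using y(1) by simp
qed

sublocale E: ergodic_measurable_flow m0 \<phi>
proof -
  have meas: "\<phi> t \<in> m0 \<rightarrow>\<^sub>M m0" for t
  proof (rule measurableI)
    fix A assume A: "A \<in> sets m0"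
    then have "\<phi> t -` A \<inter> regular = flow_image \<psi> (- t) A" by (intro \<phi>_vimage) (simp add: sets_m0)
    then show "\<phi> t -` A \<inter> space m0 \<in> sets m0"
      using flow_image_m(1)[of A] A unfolding space_m0 sets_m0 by (metis Int_lower2)
  qed (simp add: space_m0 \<phi>_regular)
  show "ergodic_measurable_flow m0 \<phi>"
  proof (intro ergodic_measurable_flow.intro ergodic_measurable_flow_axioms.intro)
    show "sigma_finite_measure m0"
      unfolding m0_def by (intro sigma_finite_measure_restrict_space sigma_finite_m) simp
    show "\<phi> t \<in> m0 \<rightarrow>\<^sub>M m0" for t by (rule meas)
    show "distr m0 m0 (\<phi> t) = m0" for t
    proof (rule measure_eqI)
      fix A assume "A \<in> sets (distr m0 m0 (\<phi> t))"
      then have A: "A \<in> sets m0" by simp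
      then have A': "A \<subseteq> regular" "A \<in> sets m" by (simp_all add: sets_m0)
      have "emeasure (distr m0 m0 (\<phi> t)) A = emeasure m0 (\<phi> t -` A \<inter> regular)"
        using emeasure_distr[OF meas A] by (simp add: space_m0)
      also have "\<dots> = emeasure m (flow_image \<psi> (- t) A)"
        by (subst emeasure_m0[OF Int_lower2]) (simp add: \<phi>_vimage[OF A'(1)])
      also have "\<dots> = emeasure m0 A" using flow_image_m(2)[OF A'(2)] emeasure_m0[OF A'(1)] by simp
      finally show "emeasure (distr m0 m0 (\<phi> t)) A = emeasure m0 A" .
    qed simp
    show "\<phi> a (\<phi> t x) = \<phi> (a + t) x" "\<phi> 0 x = x" if "x \<in> space m0" for x a t
      using that \<phi>_add \<phi>_0 by (simp_all add: space_m0)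
    fix B assume "B \<in> sets m0" and inv: "\<And>t x. x \<in> B \<Longrightarrow> \<phi> t x \<in> B"
    then have B: "B \<subseteq> regular" "B \<in> sets m" by (simp_all add: sets_m0)
    \<comment> \<open>Exact invariance under the group makes the symmetric differences in the given
      notion of ergodicity empty.\<close>
    have "flow_image \<psi> t B = B" for t
    proof -
      have "\<phi> (- t) -` B \<inter> regular = B"
      proof (intro set_eqI iffI)
        fix x assume x: "x \<in> \<phi> (- t) -` B \<inter> regular"
        then have "\<phi> t (\<phi> (- t) x) \<in> B" using inv by blast
        then show "x \<in> B" using x \<phi>_add[of x t "- t"] \<phi>_0[of x] by simp
      qed (use inv B in auto)
      then show ?thesis using \<phi>_vimage[OF B(1), of "- t"] by simp
    qed
    then have "sym_diff (flow_image \<psi> t B) B \<in> null_sets m" for t by simp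
    then have "B \<in> null_sets m \<or> space m - B \<in> null_sets m"
      using ergodic_m B(2) unfolding ergodic_flow_def by blast
    then show "B \<in> null_sets m0 \<or> space m0 - B \<in> null_sets m0"
    proof
      assume "space m - B \<in> null_sets m"
      then have "space m0 - B \<in> null_sets m"
        by (rule null_sets_subset) (use B regular_space in \<open>auto simp: space_m0\<close>)
      then show ?thesis by (auto simp: null_sets_m0 space_m0)
    qed (simp add: null_sets_m0 B)
  qed
qed

lemma AE_m0: "(AE x in m0. P x) \<Longrightarrow> AE x in m. x \<in> regular \<and> P x"
  unfolding m0_def using AE_regular by (subst (asm) AE_restrict_space_iff) auto

text \<open>Touching rhombi can tile the plane. The table is then contained in countably many
  frontiers of convex sets, the phase space is null, and every almost-everywhere statement is
  vacuous. This case is split off because the weights then have integral 0.\<close>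

lemma AE_trivial_if_no_interior:
  assumes "interior (table s g) = {}"
  shows "AE x in m. P x"
proof -
  have "table s g \<subseteq> (\<Union>z\<in>g. frontier (tree s z))"
    using boundary_table assms by blast
  moreover have "frontier (tree s z) \<in> null_sets lborel" for z
    using negligible_convex_frontier[OF convex_tree, of s z]
    by (simp add: negligible_iff_null_sets null_sets_completion_iff frontier_def closed_tree)
  then have "(\<Union>z\<in>g. frontier (tree s z)) \<in> null_sets lborel"
    using conf by (intro null_sets_UN') (auto simp: Conf_def)
  ultimately have "table s g \<in> null_sets lborel"
    by (rule null_sets_subset[rotated 2]) simp
  then have "emeasure (restrict_space lborel (table s g)) (table s g) = 0"
    by (simp add: emeasure_restrict_space null_sets_def)
  then have "emeasure m (table s g \<times> directions \<theta>) = 0"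
    unfolding phase_measure_def
    by (subst sigma_finite_measure.emeasure_pair_measure_Times[OF sigma_finite_directions])
      (auto simp: sets_restrict_space_iff)
  then have "space m \<in> null_sets m" by (simp add: space_m[symmetric] null_sets_def)
  then show ?thesis by (rule AE_I') auto
qed

section \<open>Visits to small balls and infinite occupation\<close>

lemma flow_straight:
  assumes x: "x \<in> regular" and ball: "ball (fst (\<phi> a x)) r \<subseteq> interior (table s g)" and t: "\<bar>t - a\<bar> < r"
  shows "snd (\<phi> t x) = snd (\<phi> a x)" "dist (fst (\<phi> a x)) (fst (\<phi> t x)) = \<bar>t - a\<bar>"
proof -
  obtain \<Gamma> where \<Gamma>: "orbit UNIV \<Gamma>" "\<And>t. \<phi> t x = \<Gamma> t" using x by (metis regular_orbit)
  have u: "snd (\<Gamma> a) \<in> directions \<theta>" using orbit_state(2)[OF \<Gamma>(1)] by simp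
  have eq: "\<Gamma> t = (fst (\<Gamma> a) + of_real (t - a) * velocity (snd (\<Gamma> a)), snd (\<Gamma> a))"
    by (rule orbit_straight[OF \<Gamma>(1) _ t]) (use ball \<Gamma>(2) in simp)
  show "snd (\<phi> t x) = snd (\<phi> a x)" unfolding \<Gamma>(2) by (subst eq) simp
  show "dist (fst (\<phi> a x)) (fst (\<phi> t x)) = \<bar>t - a\<bar>"
    unfolding \<Gamma>(2) by (subst eq)
      (simp add: dist_norm norm_mult norm_velocity[OF norm_directions[OF u]] del: of_real_diff)
qed

text \<open>The states that visit at a rational time form a measurable set. It is exactly invariant
  because straight motion makes the set of visiting times open, so any visit can be moved to a
  shifted rational time. It contains almost all of \<open>ball q r \<times> {j}\<close>, hence has
  positive measure, and ergodicity makes it full.\<close>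

lemma AE_visits:
  assumes ball: "ball q r \<subseteq> interior (table s g)" and r: "r > 0" and j: "j \<in> directions \<theta>"
  shows "AE x in m0. \<exists>t. \<phi> t x \<in> ball q r \<times> {j}"
proof -
  define A where "A = (ball q r \<times> {j}) \<inter> regular"
  have A_eq: "A = (ball q r \<times> {j}) \<inter> space m \<inter> regular" using regular_space by (auto simp: A_def)
  have A: "A \<in> sets m0"
    unfolding sets_m0 using sets_m_rectangle[of "ball q r" j] unfolding A_eq by auto
  define V where "V = (\<Union>a\<in>\<rat>. \<phi> a -` A \<inter> space m0)"
  have V: "V \<in> sets m0"
    unfolding V_def using A by (intro sets.countable_UN' countable_rat measurable_sets[OF E.flow_measurable]) auto
  have "\<phi> t x \<in> V" if xV: "x \<in> V" for t x
  proof -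
    obtain a where a: "\<phi> a x \<in> A" and x: "x \<in> regular" using xV by (auto simp: V_def space_m0)
    \<comment> \<open>The distance left to the boundary of the ball: for this long the orbit stays
      inside it with unchanged direction.\<close>
    define \<rho> where "\<rho> = r - dist q (fst (\<phi> a x))"
    have "\<rho> > 0" using a by (auto simp: A_def \<rho>_def)
    then obtain b where b: "b \<in> \<rat>" "a - t < b" "b < a - t + \<rho>"
      using Rats_dense_in_real[of "a - t" "a - t + \<rho>"] by auto
    have sub: "ball (fst (\<phi> a x)) \<rho> \<subseteq> ball q r"
      by (simp add: ball_subset_ball_iff \<rho>_def dist_commute)
    have d: "\<bar>b + t - a\<bar> < \<rho>" using b by linarith
    have sub': "ball (fst (\<phi> a x)) \<rho> \<subseteq> interior (table s g)" using sub ball by blast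
    have "fst (\<phi> (b + t) x) \<in> ball (fst (\<phi> a x)) \<rho>"
      using flow_straight(2)[OF x sub' d] d by simp
    then have "\<phi> (b + t) x \<in> ball q r \<times> {j}"
      using flow_straight(1)[OF x sub' d] sub a unfolding A_def mem_Times_iff by auto
    then have "\<phi> b (\<phi> t x) \<in> A"
      using \<phi>_add[OF x] \<phi>_regular[OF x] by (simp add: A_def)
    then show ?thesis using b(1) \<phi>_regular[OF x] by (auto simp: V_def space_m0)
  qed
  then have "V \<in> null_sets m0 \<or> space m0 - V \<in> null_sets m0" by (rule E.ergodic[OF V])
  moreover have "V \<notin> null_sets m0"
  proof
    assume "V \<in> null_sets m0"
    then have "V \<in> null_sets m" by (simp add: null_sets_m0)
    from AE_not_in[OF this] AE_regular have "AE x in m. x \<notin> (ball q r \<times> {j}) \<inter> space m"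
    proof eventually_elim
      case (elim x)
      have "x \<in> V" if "x \<in> A"
        unfolding V_def using that \<phi>_0[of x] by (intro UN_I[of 0]) (auto simp: A_def space_m0)
      then show ?case using elim by (auto simp: A_def)
    qed
    then have "(ball q r \<times> {j}) \<inter> space m \<in> null_sets m"
      using sets_m_rectangle[of "ball q r" j] by (subst (asm) AE_iff_null_sets[symmetric]) auto
    then have "emeasure lborel (ball q r \<inter> table s g) = 0"
      using emeasure_m_rectangle[of "ball q r" j] j by (simp add: null_sets_def)
    moreover have "ball q r \<inter> table s g = ball q r" using ball interior_subset by blast
    ultimately have "emeasure lborel (ball q r) = 0" by simp
    then show False using r by (simp add: emeasure_ball unit_ball_vol_2)
  qed
  ultimately have "space m0 - V \<in> null_sets m0" by blast
  from AE_not_in[OF this] AE_space show ?thesis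
  proof eventually_elim
    case (elim x)
    then have "x \<in> V" by blast
    then obtain a where "\<phi> a x \<in> A" unfolding V_def by blast
    then have "\<phi> a x \<in> ball q r \<times> {j}" by (simp only: A_def Int_iff)
    then show ?case by (rule exI)
  qed
qed

text \<open>The phase measure gives every direction the same copy of area on the table, so the
  integral does not depend on \<open>i\<close>. This is why the limit of the ratios is 1.\<close>

lemma observable_cube_weight:
  assumes i: "i \<in> directions \<theta>"
  shows "E.observable (cube_weight i)"
    and "integral\<^sup>L m0 (cube_weight i) = enn2real (\<integral>\<^sup>+z\<in>table s g. ennreal (1 / max 1 (cmod z ^ 3)) \<partial>lborel)"
proof -
  let ?W = "\<integral>\<^sup>+z\<in>table s g. ennreal (1 / max 1 (cmod z ^ 3)) \<partial>lborel"
  have meas[measurable]: "cube_weight i \<in> borel_measurable m0"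
    unfolding m0_def by (rule measurable_restrict_space1) measurable
  have "(\<integral>\<^sup>+x. ennreal (cube_weight i x) \<partial>m0) = (\<integral>\<^sup>+x. ennreal (cube_weight i x) * indicator regular x \<partial>m)"
    unfolding m0_def by (rule nn_integral_restrict_space) simp
  also have "\<dots> = (\<integral>\<^sup>+x. (if snd x = i then ennreal (1 / max 1 (cmod (fst x) ^ 3)) else 0) \<partial>m)"
    using AE_regular by (intro nn_integral_cong_AE) (auto simp: cube_weight_def elim!: eventually_mono)
  also have "\<dots> = ?W" by (rule nn_integral_m_direction[OF _ i]) measurable
  finally have W: "(\<integral>\<^sup>+x. ennreal (cube_weight i x) \<partial>m0) = ?W" .
  have "?W \<le> (\<integral>\<^sup>+z. ennreal (1 / max 1 (cmod z ^ 3)) \<partial>lborel)"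
    by (intro nn_integral_mono) (auto simp: indicator_def)
  also note nn_integral_inverse_cube
  finally have fin: "?W < \<infinity>" .
  then have int: "integrable m0 (cube_weight i)"
    using W cube_weight_bounds by (intro integrableI_nonneg) auto
  have "(\<lambda>(t, x). cube_weight i (\<phi> t x)) \<in> borel_measurable (lborel \<Otimes>\<^sub>M m0)"
  proof (rule right_continuous_joint_measurable)
    show "(\<lambda>x. cube_weight i (\<phi> t x)) \<in> borel_measurable m0" for t by measurable
    fix x t assume "x \<in> space m0"
    then obtain \<Gamma> where \<Gamma>: "orbit UNIV \<Gamma>" "\<And>t. \<phi> t x = \<Gamma> t" by (metis regular_orbit space_m0)
    show "continuous (at_right t) (\<lambda>t. cube_weight i (\<phi> t x))"
      unfolding \<Gamma>(2) by (rule orbit_right_continuous[OF \<Gamma>(1) continuous_cube_weight])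
  qed
  then show "E.observable (cube_weight i)"
    unfolding E.observable_def using int cube_weight_bounds by auto
  show "integral\<^sup>L m0 (cube_weight i) = enn2real ?W"
    using W cube_weight_bounds by (subst integral_eq_nn_integral) auto
qed

lemma integral_cube_weight_pos:
  assumes i: "i \<in> directions \<theta>" and ne: "interior (table s g) \<noteq> {}"
  shows "integral\<^sup>L m0 (cube_weight i) > 0"
proof -
  let ?h = "\<lambda>z. ennreal (1 / max 1 (cmod z ^ 3)) * indicator (table s g) z"
  have "integral\<^sup>N lborel ?h \<noteq> 0"
  proof
    assume "integral\<^sup>N lborel ?h = 0"
    then have "AE z in lborel. ?h z = 0" by (subst (asm) nn_integral_0_iff_AE) auto
    then have "AE z in lborel. z \<notin> interior (table s g)"
      by eventually_elim (use interior_subset[of "table s g"] in \<open>auto simp: indicator_def ennreal_eq_0_iff split: if_splits\<close>)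
    then have "interior (table s g) \<in> null_sets lborel"
      by (subst (asm) AE_iff_null_sets[symmetric]) auto
    then show False using ne open_not_negligible[OF open_interior, of "table s g"]
      by (simp add: negligible_iff_null_sets null_sets_completion_iff)
  qed
  moreover have "integral\<^sup>N lborel ?h < \<infinity>"
  proof -
    have "integral\<^sup>N lborel ?h \<le> (\<integral>\<^sup>+z. ennreal (1 / max 1 (cmod z ^ 3)) \<partial>lborel)"
      by (intro nn_integral_mono) (auto simp: indicator_def)
    also note nn_integral_inverse_cube
    finally show ?thesis .
  qed
  ultimately show ?thesis
    unfolding observable_cube_weight(2)[OF i] by (simp add: enn2real_positive_iff zero_less_iff_neq_zero)
qed

text \<open>An orbit visits each of the \<open>N\<^sup>2\<close> balls of radius \<open>r \<sim> 1/N\<close> in a grid and spends time at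
  least \<open>2 r\<close> near each of them, so that its total occupation time of the grid is of order \<open>N\<close>.\<close>

lemma AE_occupation_infinite:
  assumes j: "j \<in> directions \<theta>" and ne: "interior (table s g) \<noteq> {}"
  shows "AE x in m0. emeasure (E.occ (cube_weight j) x) UNIV = \<infinity>"
proof -
  obtain p where "p \<in> interior (table s g)" using ne by auto
  then obtain R where R: "R > 0" "ball p R \<subseteq> interior (table s g)"
    using open_interior open_contains_ball by blast
  \<comment> \<open>Grid points have spacing \<open>4 r\<close> and indices up to \<open>N\<close>,
    so they lie within \<open>8 N r\<close> of \<open>p\<close>. With discs of radius
    \<open>2 r\<close> around them this stays below \<open>10 (N + 1) r = R\<close>.\<close>
  define r where "r N = R / (10 * real (Suc N))" for N
  define q where "q N ab = p + of_real (4 * r N) * Complex (real (fst ab)) (real (snd ab))" for N and ab :: "nat \<times> nat"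
  define I where "I N = {..N} \<times> {..N}" for N :: nat
  define \<delta> where "\<delta> = 1 / max 1 ((cmod p + R) ^ 3)"
  have \<delta>: "\<delta> > 0" by (simp add: \<delta>_def)
  have r: "r N > 0" for N using R by (simp add: r_def)
  have r_sum: "4 * r N * (2 * real N) + 2 * r N \<le> R" for N
  proof -
    have "R = 10 * real (Suc N) * r N" by (simp add: r_def)
    moreover have "real N * r N \<ge> 0" using r[of N] by simp
    ultimately show ?thesis using r[of N] by (simp add: algebra_simps)
  qed
  have q_sub: "ball (q N ab) (2 * r N) \<subseteq> ball p R" if "ab \<in> I N" for N ab
  proof -
    have "cmod (Complex (real (fst ab)) (real (snd ab))) \<le> real (fst ab) + real (snd ab)"
      using cmod_le[of "Complex (real (fst ab)) (real (snd ab))"] by simp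
    also have "\<dots> \<le> 2 * real N" using that by (auto simp: I_def)
    finally have "4 * r N * cmod (Complex (real (fst ab)) (real (snd ab))) \<le> 4 * r N * (2 * real N)"
      using r[of N] by (intro mult_left_mono) auto
    moreover have "dist (q N ab) p = 4 * r N * cmod (Complex (real (fst ab)) (real (snd ab)))"
      using r[of N] by (simp add: q_def dist_norm norm_mult)
    ultimately have "dist (q N ab) p + 2 * r N \<le> R"
      using r_sum[of N] by linarith
    then show ?thesis by (simp add: ball_subset_ball_iff)
  qed
  have q_dist: "dist (q N ab) (q N cd) \<ge> 4 * r N" if "ab \<noteq> cd" for N ab cd
  proof -
    let ?z = "Complex (real (fst ab) - real (fst cd)) (real (snd ab) - real (snd cd))"
    have nat_dist: "1 \<le> \<bar>real a - real b\<bar>" if "a \<noteq> b" for a b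
      using that by (cases a b rule: linorder_cases) auto
    have "1 \<le> cmod ?z"
    proof (cases "fst ab = fst cd")
      case True
      then have "snd ab \<noteq> snd cd" using that by (simp add: prod_eq_iff)
      then have "1 \<le> \<bar>Im ?z\<bar>" using nat_dist by simp
      then show ?thesis using abs_Im_le_cmod[of ?z] by linarith
    next
      case False
      then have "1 \<le> \<bar>Re ?z\<bar>" using nat_dist by simp
      then show ?thesis using abs_Re_le_cmod[of ?z] by linarith
    qed
    moreover have "q N ab - q N cd = of_real (4 * r N) * ?z"
      by (simp add: q_def complex_eq_iff algebra_simps)
    ultimately show ?thesis using r[of N] by (simp add: dist_norm norm_mult)
  qed
  have "AE x in m0. \<exists>t. \<phi> t x \<in> ball (q N ab) (r N) \<times> {j}" if "ab \<in> I N" for N ab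
    using q_sub[OF that] r[of N] R(2) j by (intro AE_visits) (auto simp: subset_iff)
  then have "AE x in m0. \<forall>N. \<forall>ab\<in>I N. \<exists>t. \<phi> t x \<in> ball (q N ab) (r N) \<times> {j}"
    unfolding AE_all_countable by (subst AE_ball_countable) (auto simp: I_def)
  then show ?thesis using AE_space
  proof eventually_elim
    case (elim x)
    then have x: "x \<in> regular" by (simp add: space_m0)
    note obs = observable_cube_weight(1)[OF j]
    have bound: "ennreal (\<delta> * R / 5 * real (Suc N)) \<le> emeasure (E.occ (cube_weight j) x) UNIV" for N
    proof -
      obtain t where t: "\<And>ab. ab \<in> I N \<Longrightarrow> \<phi> (t ab) x \<in> ball (q N ab) (r N) \<times> {j}"
        using elim(1) by metis
      define J where "J ab = {t ab - r N<..<t ab + r N}" for ab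
      \<comment> \<open>A visit to the disc of radius \<open>r\<close> keeps the orbit in the
        concentric disc of radius \<open>2 r\<close> for time \<open>r\<close> both before and
        after. Spacing \<open>4 r\<close> makes the larger discs disjoint, hence also the time
        intervals \<open>J\<close>.\<close>
      have stay: "\<phi> \<tau> x \<in> ball (q N ab) (2 * r N) \<times> {j}" if ab: "ab \<in> I N" and \<tau>: "\<tau> \<in> J ab" for ab \<tau>
      proof -
        have "ball (fst (\<phi> (t ab) x)) (r N) \<subseteq> ball (q N ab) (2 * r N)"
          using t[OF ab] by (auto simp: ball_subset_ball_iff mem_Times_iff dist_commute)
        moreover have "ball (q N ab) (2 * r N) \<subseteq> interior (table s g)" using q_sub[OF ab] R(2) by blast
        ultimately have sub: "ball (fst (\<phi> (t ab) x)) (r N) \<subseteq> interior (table s g)" by blast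
        have d: "\<bar>\<tau> - t ab\<bar> < r N" using \<tau> by (auto simp: J_def)
        have "dist (q N ab) (fst (\<phi> \<tau> x)) < 2 * r N"
          using flow_straight(2)[OF x sub d] d t[OF ab]
            dist_triangle[of "q N ab" "fst (\<phi> \<tau> x)" "fst (\<phi> (t ab) x)"]
          by (auto simp: mem_Times_iff)
        then show ?thesis
          using flow_straight(1)[OF x sub d] t[OF ab] by (auto simp: mem_Times_iff)
      qed
      have J_disj: "disjoint_family_on J (I N)"
        unfolding disjoint_family_on_def
      proof (intro ballI impI)
        fix ab cd assume *: "ab \<in> I N" "cd \<in> I N" "ab \<noteq> cd"
        have False if "\<tau> \<in> J ab" "\<tau> \<in> J cd" for \<tau>
          using stay[OF *(1) that(1)] stay[OF *(2) that(2)] q_dist[OF *(3), of N]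
            dist_triangle2[of "q N ab" "q N cd" "fst (\<phi> \<tau> x)"] by (auto simp: mem_Times_iff)
        then show "J ab \<inter> J cd = {}" by blast
      qed
      have weight: "cube_weight j (\<phi> \<tau> x) \<ge> \<delta>" if "ab \<in> I N" "\<tau> \<in> J ab" for ab \<tau>
      proof -
        have st: "snd (\<phi> \<tau> x) = j" "dist p (fst (\<phi> \<tau> x)) < R"
          using stay[OF that] q_sub[OF that(1)] by (auto simp: mem_Times_iff)
        have "cmod (fst (\<phi> \<tau> x)) \<le> cmod p + R"
          using st(2) norm_triangle_sub[of "fst (\<phi> \<tau> x)" p] by (simp add: dist_norm norm_minus_commute)
        then have "cmod (fst (\<phi> \<tau> x)) ^ 3 \<le> (cmod p + R) ^ 3" by (intro power_mono) auto
        then show ?thesis by (simp add: cube_weight_def st(1) \<delta>_def frac_le max.coboundedI2)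
      qed
      have fin: "finite (I N)" by (simp add: I_def)
      have "emeasure lborel (\<Union>ab\<in>I N. J ab) = (\<Sum>ab\<in>I N. emeasure lborel (J ab))"
        by (rule sum_emeasure[symmetric, OF _ J_disj fin]) (auto simp: J_def)
      also have "\<dots> = (\<Sum>ab\<in>I N. ennreal (2 * r N))"
        using r[of N] by (intro sum.cong) (auto simp: J_def)
      also have "\<dots> = ennreal (\<Sum>ab\<in>I N. 2 * r N)"
        using r[of N] by (intro sum_ennreal) simp
      also have "(\<Sum>ab\<in>I N. 2 * r N) = real (Suc N) * real (Suc N) * (2 * r N)"
        by (simp add: I_def algebra_simps)
      also have "\<dots> = R / 5 * real (Suc N)"
        by (simp add: r_def field_simps del: of_nat_Suc)
      finally have meas: "emeasure lborel (\<Union>ab\<in>I N. J ab) = ennreal (R / 5 * real (Suc N))" .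
      have "ennreal (\<delta> * R / 5 * real (Suc N)) = ennreal \<delta> * emeasure lborel (\<Union>ab\<in>I N. J ab)"
        unfolding meas using \<delta> R by (subst ennreal_mult[symmetric]) auto
      also have "\<dots> = (\<integral>\<^sup>+\<tau>. ennreal \<delta> * indicator (\<Union>ab\<in>I N. J ab) \<tau> \<partial>lborel)"
        by (rule nn_integral_cmult_indicator[symmetric]) (auto simp: J_def)
      also have "\<dots> \<le> (\<integral>\<^sup>+\<tau>. ennreal (cube_weight j (\<phi> \<tau> x)) * indicator UNIV \<tau> \<partial>lborel)"
        using weight by (intro nn_integral_mono) (auto simp: indicator_def intro!: ennreal_leI)
      also have "\<dots> = emeasure (E.occ (cube_weight j) x) UNIV"
        using x by (subst E.emeasure_occ[OF obs]) (auto simp: space_m0)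
      finally show ?thesis .
    qed
    show ?case
    proof (rule ccontr)
      assume "emeasure (E.occ (cube_weight j) x) UNIV \<noteq> \<infinity>"
      then obtain c where c: "c \<ge> 0" "emeasure (E.occ (cube_weight j) x) UNIV = ennreal c"
        by (cases "emeasure (E.occ (cube_weight j) x) UNIV") auto
      obtain N where "c / (\<delta> * R / 5) < real N" using reals_Archimedean2 by blast
      then have "c < \<delta> * R / 5 * real (Suc N)"
        using \<delta> R by (simp add: field_simps) (smt (verit) mult_pos_pos)
      then show False using bound[of N] c by simp
    qed
  qed
qed

section \<open>From occupation times to the product flow\<close>

lemma integral_cube_weight:
  assumes i: "i \<in> directions \<theta>" and x: "x \<in> regular" and T: "T \<ge> 0"
  shows "((\<lambda>t. cube_weight i (\<phi> t x)) has_integral measure (E.occ (cube_weight i) x) {0..<T}) {0..T}"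
proof -
  note obs = observable_cube_weight(1)[OF i]
  have x0: "x \<in> space m0" using x by (simp add: space_m0)
  have [measurable]: "(\<lambda>t. cube_weight i (\<phi> t x)) \<in> borel_measurable borel"
    by (rule E.obs_time_measurable[OF obs x0])
  let ?f = "\<lambda>t. cube_weight i (\<phi> t x) * indicator {0..T} t"
  \<comment> \<open>Half-open windows served to tile time, whereas the integral runs over a closed
    interval; the end point carries no occupation.\<close>
  have "{T} \<in> null_sets (E.occ (cube_weight i) x)"
    using E.emeasure_occ_le[OF obs x0, of "{T}"] by (simp add: null_sets_def)
  then have "emeasure (E.occ (cube_weight i) x) ({0..<T} \<union> {T}) = emeasure (E.occ (cube_weight i) x) {0..<T}"
    by (intro emeasure_Un_null_set) auto
  moreover have "{0..<T} \<union> {T} = {0..T}" using T by auto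
  ultimately have "(\<integral>\<^sup>+t. ennreal (cube_weight i (\<phi> t x)) * indicator {0..T} t \<partial>lborel)
      = emeasure (E.occ (cube_weight i) x) {0..<T}"
    using E.emeasure_occ[OF obs x0, of "{0..T}"] by simp
  also have "\<dots> = ennreal (measure (E.occ (cube_weight i) x) {0..<T})"
    using E.emeasure_occ_Ico_finite[OF obs x0] by (intro emeasure_eq_ennreal_measure) auto
  finally have "(\<integral>\<^sup>+t. ennreal (?f t) \<partial>lborel) = ennreal (measure (E.occ (cube_weight i) x) {0..<T})"
    by (simp add: ennreal_mult' cube_weight_bounds ennreal_indicator)
  then have "(?f has_integral measure (E.occ (cube_weight i) x) {0..<T}) UNIV"
    by (intro nn_integral_has_integral) (auto simp: cube_weight_bounds)
  moreover have "?f = (\<lambda>t. if t \<in> {0..T} then cube_weight i (\<phi> t x) else 0)"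
    by (auto simp: indicator_def)
  ultimately show ?thesis by (simp only: has_integral_restrict_UNIV)
qed

lemma AE_ratio:
  assumes i: "i \<in> directions \<theta>" and j: "j \<in> directions \<theta>"
  shows "AE x in m. x \<in> regular \<and>
    filterlim (\<lambda>T. measure (E.occ (cube_weight j) x) {0..<T}) at_top at_top \<and>
    ((\<lambda>T. measure (E.occ (cube_weight i) x) {0..<T} / measure (E.occ (cube_weight j) x) {0..<T}) \<longlongrightarrow> 1) at_top"
proof (cases "interior (table s g) = {}")
  case True
  then show ?thesis by (rule AE_trivial_if_no_interior)
next
  case False
  note obs = observable_cube_weight(1)
  have inf: "AE x in m0. emeasure (E.occ (cube_weight k) x) {0..} = \<infinity>" if "k \<in> directions \<theta>" for k
    by (rule E.AE_future_infinite[OF obs[OF that] AE_occupation_infinite[OF that False]])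
  have "AE x in m0. ((\<lambda>T. measure (E.occ (cube_weight i) x) {0..<T} / measure (E.occ (cube_weight j) x) {0..<T}) \<longlongrightarrow> 1) at_top"
    using observable_cube_weight(2) i j integral_cube_weight_pos[OF i False]
    by (intro E.ratio_limit obs inf) simp_all
  then have "AE x in m0. filterlim (\<lambda>T. measure (E.occ (cube_weight j) x) {0..<T}) at_top at_top \<and>
    ((\<lambda>T. measure (E.occ (cube_weight i) x) {0..<T} / measure (E.occ (cube_weight j) x) {0..<T}) \<longlongrightarrow> 1) at_top"
    using inf[OF j] AE_space by eventually_elim (auto intro: E.measure_occ_at_top[OF obs[OF j]])
  then show ?thesis by (rule AE_m0)
qed

end

text \<open>The relative errors are measured against \<open>b k\<close>, so they add up to a
  relative error of the sum. Different summands may grow at entirely different rates, as the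
  occupations of different particles may.\<close>

lemma tendsto_ratio_sum:
  fixes a b :: "'k \<Rightarrow> 'x \<Rightarrow> real"
  assumes I: "finite I" "I \<noteq> {}"
    and lim: "\<And>k. k \<in> I \<Longrightarrow> ((\<lambda>x. a k x / b k x) \<longlongrightarrow> 1) F"
    and pos: "\<And>k. k \<in> I \<Longrightarrow> eventually (\<lambda>x. b k x > 0) F"
  shows "((\<lambda>x. (\<Sum>k\<in>I. a k x) / (\<Sum>k\<in>I. b k x)) \<longlongrightarrow> 1) F"
proof (rule tendstoI)
  fix e :: real assume e: "e > 0"
  have "eventually (\<lambda>x. \<forall>k\<in>I. dist (a k x / b k x) 1 < e / 2 \<and> b k x > 0) F"
    using lim pos tendstoD[OF lim, of _ "e / 2"] e I(1)
    by (intro eventually_ball_finite ballI eventually_conj) auto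
  then show "eventually (\<lambda>x. dist ((\<Sum>k\<in>I. a k x) / (\<Sum>k\<in>I. b k x)) 1 < e) F"
  proof eventually_elim
    case (elim x)
    have "\<bar>a k x - b k x\<bar> \<le> e / 2 * b k x" if "k \<in> I" for k
    proof -
      have b: "b k x > 0" and d: "\<bar>a k x / b k x - 1\<bar> < e / 2"
        using elim that by (auto simp: dist_real_def)
      have "a k x - b k x = (a k x / b k x - 1) * b k x" using b by (simp add: field_simps)
      then have "\<bar>a k x - b k x\<bar> = \<bar>a k x / b k x - 1\<bar> * b k x" using b by (simp only: abs_mult abs_of_pos)
      then show ?thesis using mult_right_mono[of "\<bar>a k x / b k x - 1\<bar>" "e / 2" "b k x"] b d by simp
    qed
    then have "\<bar>(\<Sum>k\<in>I. a k x - b k x)\<bar> \<le> (\<Sum>k\<in>I. e / 2 * b k x)"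
      by (intro order_trans[OF sum_abs] sum_mono) auto
    then have le: "\<bar>(\<Sum>k\<in>I. a k x) - (\<Sum>k\<in>I. b k x)\<bar> \<le> e / 2 * (\<Sum>k\<in>I. b k x)"
      by (simp add: sum_subtractf sum_distrib_left)
    have B: "(\<Sum>k\<in>I. b k x) > 0" using elim I by (intro sum_pos) auto
    have "(\<Sum>k\<in>I. a k x) / (\<Sum>k\<in>I. b k x) - 1 = ((\<Sum>k\<in>I. a k x) - (\<Sum>k\<in>I. b k x)) / (\<Sum>k\<in>I. b k x)"
      using B by (simp add: diff_divide_distrib)
    then have "dist ((\<Sum>k\<in>I. a k x) / (\<Sum>k\<in>I. b k x)) 1 \<le> e / 2"
      using le B by (simp add: dist_real_def abs_divide pos_divide_le_eq)
    then show ?case using e by linarith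
  qed
qed

theorem corollary6:
  fixes s :: real and K :: nat and G :: "complex set set" and H :: "complex set"
  assumes "s > 0" and "K \<ge> 1"
    and "G \<subseteq> Conf s" and "dense_gdelta_in (conf_topology s) G"
    and "H \<subseteq> circle" and "dense_gdelta_in (top_of_set circle) H" and "full_measure_on_circle H"
    and "\<And>g \<theta>. g \<in> G \<Longrightarrow> \<theta> \<in> H \<Longrightarrow>
           infinite_ergodic_index (phase_measure s g \<theta>) (billiard_flow s g \<theta>)"
  shows "\<forall>g\<in>G. \<forall>\<theta>\<in>H. \<forall>i\<in>directions \<theta>. \<forall>j\<in>directions \<theta>.
    AE x in power_measure K (phase_measure s g \<theta>).
      (\<forall>t\<ge>0. power_flow K (billiard_flow s g \<theta>) t x \<noteq> None) \<and>
      ((\<lambda>T. integral {0..T} (\<lambda>t. f_hat K i (the (power_flow K (billiard_flow s g \<theta>) t x))) /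
            integral {0..T} (\<lambda>t. f_hat K j (the (power_flow K (billiard_flow s g \<theta>) t x)))) \<longlongrightarrow> 1)
        at_top"
proof (intro ballI)
  fix g \<theta> i j assume g: "g \<in> G" and \<theta>: "\<theta> \<in> H" and i: "i \<in> directions \<theta>" and j: "j \<in> directions \<theta>"
  interpret wind_tree s g \<theta>
    using assms(1,3,5) g \<theta> by unfold_locales auto
  interpret ergodic_wind_tree s g \<theta>
  proof
    show "ergodic_flow m (billiard_flow s g \<theta>)"
    proof (rule ergodic_flow_of_power_1[OF sigma_finite_m])
      show "ergodic_flow (power_measure 1 m) (power_flow 1 (billiard_flow s g \<theta>))"
        using assms(8)[OF g \<theta>] unfolding infinite_ergodic_index_def by blast
    qed (use billiard_flow_space in \<open>simp add: space_m\<close>)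
  qed
  show "AE x in power_measure K m. (\<forall>t\<ge>0. power_flow K \<psi> t x \<noteq> None) \<and>
      ((\<lambda>T. integral {0..T} (\<lambda>t. f_hat K i (the (power_flow K \<psi> t x))) /
            integral {0..T} (\<lambda>t. f_hat K j (the (power_flow K \<psi> t x)))) \<longlongrightarrow> 1) at_top"
    using AE_power_measure[OF sigma_finite_m AE_ratio[OF i j], of K]
  proof eventually_elim
    case (elim x)
    define S where "S l k T = measure (E.occ (cube_weight l) (x k)) {0..<T}" for l k T
    have reg: "x k \<in> regular" if "k < K" for k using elim that by blast
    have pf: "power_flow K \<psi> t x = Some (\<lambda>k\<in>{..<K}. \<phi> t (x k))" for t
    proof -
      have "\<psi> t (x k) = Some (\<phi> t (x k))" if "k < K" for k
        using regular_orbit[OF reg[OF that]] by metis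
      then show ?thesis by (auto simp: power_flow_def fun_eq_iff)
    qed
    have int: "integral {0..T} (\<lambda>t. f_hat K l (the (power_flow K \<psi> t x))) = (\<Sum>k<K. S l k T)"
      if "l \<in> directions \<theta>" "T \<ge> 0" for l T
    proof (rule integral_unique)
      have "((\<lambda>t. \<Sum>k<K. cube_weight l (\<phi> t (x k))) has_integral (\<Sum>k<K. S l k T)) {0..T}"
        unfolding S_def using that reg by (intro has_integral_sum integral_cube_weight) auto
      then show "((\<lambda>t. f_hat K l (the (power_flow K \<psi> t x))) has_integral (\<Sum>k<K. S l k T)) {0..T}"
        by (simp add: pf f_hat_eq_sum)
    qed
    have "((\<lambda>T. (\<Sum>k<K. S i k T) / (\<Sum>k<K. S j k T)) \<longlongrightarrow> 1) at_top"
    proof (rule tendsto_ratio_sum)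
      show "{..<K} \<noteq> {}" using assms(2) by (simp add: lessThan_empty_iff)
      fix k assume "k \<in> {..<K}"
      then have "filterlim (S j k) at_top at_top" "((\<lambda>T. S i k T / S j k T) \<longlongrightarrow> 1) at_top"
        using elim unfolding S_def by auto
      then show "((\<lambda>T. S i k T / S j k T) \<longlongrightarrow> 1) at_top" "eventually (\<lambda>T. S j k T > 0) at_top"
        by (auto simp: filterlim_at_top_dense)
    qed simp
    \<comment> \<open>The identification of the integrals with occupation times is available for
      \<open>T \<ge> 0\<close>, which suffices for the limit at infinity.\<close>
    moreover have "eventually (\<lambda>T. (\<Sum>k<K. S i k T) / (\<Sum>k<K. S j k T) =
        integral {0..T} (\<lambda>t. f_hat K i (the (power_flow K \<psi> t x))) /
        integral {0..T} (\<lambda>t. f_hat K j (the (power_flow K \<psi> t x)))) at_top"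
      using eventually_ge_at_top[of 0] by eventually_elim (simp only: int[OF i] int[OF j])
    ultimately have "((\<lambda>T. integral {0..T} (\<lambda>t. f_hat K i (the (power_flow K \<psi> t x))) /
            integral {0..T} (\<lambda>t. f_hat K j (the (power_flow K \<psi> t x)))) \<longlongrightarrow> 1) at_top"
      by (rule Lim_transform_eventually)
    then show ?case by (simp add: pf)
  qed
qed

end
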